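(* Let $S\subset\mathbb H^3$ be a complete surface with a connected cone-like end $C\subset\partial_\infty\mathbb H^3$. If $K$ denotes the extrinsic curvature of $S$ and $dS$ is the (hyperbolic) area element, then $$\int_S K\,dS$$ is absolutely convergent.
   Context: The Poincaré half-space model is $\mathbb H^3=\{x\in\mathbb R^3: x_3>0\}$ with metric $x_3^{-2}(dx_1^2+dx_2^2+dx_3^2)$; $\partial_\infty\mathbb H^3$ is identified with $\mathbb R^2=\{x_3=0\}$ (together with $\infty$). The extrinsic curvature $K$ is the product of the principal curvatures with respect to the hyperbolic metric. Cone-like ends: let $f\colon S\to\mathbb H^3$ be an immersion of a $\mathcal C^2$ surface $S$. $S$ has cone-like ends if (i) $S$ is the interior of a compact surface with boundary $\overline S$, and in the half-space model $f$ extends to a $\mathcal C^2$ immersion $f\colon\overline S\to\mathbb R^3$; (ii) $C=f(\partial\overline S)$ is a collection of simple closed curves contained in the boundary plane $\{x_3=0\}$; (iii) $f(\overline S)$ is orthogonal (in the Euclidean sense) to $\partial_\infty\mathbb H^3$ along $C$. The cone-like end is connected if $C$ is a single simple closed curve. *)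

theory Defs
  imports "HOL-Analysis.Analysis"
begin

section \<open>Maps of class \<open>C\<^sup>2\<close>\<close>

definition C2_open :: "'a::euclidean_space set \<Rightarrow> ('a \<Rightarrow> 'b::euclidean_space) \<Rightarrow> bool" where
  "C2_open W g \<longleftrightarrow> open W \<and>
     (\<exists>(g' :: 'a \<Rightarrow> 'a \<Rightarrow>\<^sub>L 'b) (g'' :: 'a \<Rightarrow> 'a \<Rightarrow>\<^sub>L ('a \<Rightarrow>\<^sub>L 'b)).
        (\<forall>x\<in>W. (g has_derivative blinfun_apply (g' x)) (at x)) \<and>
        (\<forall>x\<in>W. (g' has_derivative blinfun_apply (g'' x)) (at x)) \<and>
        continuous_on W g'')"

text \<open>On a set that need not be open (here: a relatively open subset of the closed half-plane),
  \<open>C\<^sup>2\<close> means that there are local \<open>C\<^sup>2\<close> extensions to open sets.\<close>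

definition C2_on :: "'a::euclidean_space set \<Rightarrow> ('a \<Rightarrow> 'b::euclidean_space) \<Rightarrow> bool" where
  "C2_on T h \<longleftrightarrow> (\<forall>x\<in>T. \<exists>W g. x \<in> W \<and> C2_open W g \<and> (\<forall>y\<in>W \<inter> T. g y = h y))"


section \<open>Surfaces with boundary\<close>

type_synonym 'p chart = "'p set \<times> ('p \<Rightarrow> real^2)"

definition half_plane :: "(real^2) set" where
  "half_plane = {u. 0 \<le> u $ 2}"

definition C2_surface_with_boundary :: "'p topology \<Rightarrow> 'p chart set \<Rightarrow> bool" where
  "C2_surface_with_boundary X \<A> \<longleftrightarrow>
     Hausdorff_space X \<and> second_countable X \<and>
     (\<Union>(U, \<phi>)\<in>\<A>. U) = topspace X \<and>
     (\<forall>(U, \<phi>)\<in>\<A>. openin X U \<and> openin (top_of_set half_plane) (\<phi> ` U) \<and>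
        homeomorphic_map (subtopology X U) (top_of_set (\<phi> ` U)) \<phi>) \<and>
     (\<forall>(U, \<phi>)\<in>\<A>. \<forall>(V, \<psi>)\<in>\<A>. C2_on (\<phi> ` (U \<inter> V)) (\<psi> \<circ> inv_into U \<phi>))"

definition surface_boundary :: "'p topology \<Rightarrow> 'p chart set \<Rightarrow> 'p set" where
  "surface_boundary X \<A> = {p \<in> topspace X. \<exists>(U, \<phi>)\<in>\<A>. p \<in> U \<and> \<phi> p $ 2 = 0}"

definition surface_interior :: "'p topology \<Rightarrow> 'p chart set \<Rightarrow> 'p set" where
  "surface_interior X \<A> = topspace X - surface_boundary X \<A>"

text \<open>The expression of \<open>f\<close> in a chart. At boundary points the differential is the one-sided one,
  taken within the chart image; it is unique there.\<close>

definition in_chart :: "('p \<Rightarrow> 'b) \<Rightarrow> 'p chart \<Rightarrow> real^2 \<Rightarrow> 'b" where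
  "in_chart f c = f \<circ> inv_into (fst c) (snd c)"

definition C2_immersion :: "'p chart set \<Rightarrow> ('p \<Rightarrow> real^3) \<Rightarrow> bool" where
  "C2_immersion \<A> f \<longleftrightarrow>
     (\<forall>(U, \<phi>)\<in>\<A>. C2_on (\<phi> ` U) (in_chart f (U, \<phi>)) \<and>
        (\<forall>u\<in>\<phi> ` U. \<exists>D. (in_chart f (U, \<phi>) has_derivative D) (at u within \<phi> ` U) \<and> inj D))"


section \<open>The half-space model\<close>

definition half_space :: "(real^3) set" where
  "half_space = {x. 0 < x $ 3}"

definition hyp_metric :: "real^3 \<Rightarrow> real^3 \<Rightarrow> real^3 \<Rightarrow> real" where
  "hyp_metric x v w = (v \<bullet> w) / (x $ 3)\<^sup>2"

text \<open>The Levi-Civita connection of \<open>hyp_metric\<close> is \<open>\<nabla>\<^sub>v Y = D\<^sub>v Y + \<Gamma>(v, Y)\<close>, with the following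
  \<open>\<Gamma>\<close>; the two lemmas say that it is torsion-free and metric, which determines it.\<close>

definition hyp_christoffel :: "real^3 \<Rightarrow> real^3 \<Rightarrow> real^3 \<Rightarrow> real^3" where
  "hyp_christoffel x v w =
     - (1 / x $ 3) *\<^sub>R (v $ 3 *\<^sub>R w + w $ 3 *\<^sub>R v - (v \<bullet> w) *\<^sub>R axis 3 1)"

lemma hyp_christoffel_sym: "hyp_christoffel x v w = hyp_christoffel x w v"
  by (simp add: hyp_christoffel_def inner_commute add.commute)

lemma hyp_christoffel_metric:
  assumes "x \<in> half_space"
  shows "((\<lambda>y. hyp_metric y v w) has_derivative
     (\<lambda>z. hyp_metric x (hyp_christoffel x z v) w + hyp_metric x v (hyp_christoffel x z w))) (at x)"
proof -
  have x: "x $ 3 \<noteq> 0" using assms by (simp add: half_space_def)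
  have eq: "hyp_metric x (hyp_christoffel x z v) w + hyp_metric x v (hyp_christoffel x z w)
      = - 2 * z $ 3 * (v \<bullet> w) / (x $ 3) ^ 3" for z
  proof -
    have e: "axis 3 1 \<bullet> w = w $ 3" "v \<bullet> axis 3 1 = v $ 3"
      by (simp_all add: inner_axis inner_axis')
    show ?thesis
      using x
      by (simp add: hyp_metric_def hyp_christoffel_def inner_diff_left inner_diff_right
          inner_add_left inner_add_right e inner_commute[of v z] field_simps
          power2_eq_square power3_eq_cube)
  qed
  have "((\<lambda>y::real^3. (v \<bullet> w) / (y $ 3)\<^sup>2) has_derivative
      (\<lambda>z. - 2 * z $ 3 * (v \<bullet> w) / (x $ 3) ^ 3)) (at x)"
    using x
    by (auto intro!: derivative_eq_intros bounded_linear.has_derivative[OF bounded_linear_vec_nth]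
        simp: fun_eq_iff field_simps power2_eq_square power3_eq_cube)
  then show ?thesis unfolding eq unfolding hyp_metric_def .
qed


section \<open>Extrinsic geometry of a parametrised surface \<open>\<psi>\<close> in the half-space\<close>

abbreviation deriv1 :: "(real^2 \<Rightarrow> real^3) \<Rightarrow> real^2 \<Rightarrow> real^2 \<Rightarrow> real^3" where
  "deriv1 \<psi> u v \<equiv> frechet_derivative \<psi> (at u) v"

abbreviation deriv2 :: "(real^2 \<Rightarrow> real^3) \<Rightarrow> real^2 \<Rightarrow> real^2 \<Rightarrow> real^2 \<Rightarrow> real^3" where
  "deriv2 \<psi> u v w \<equiv> frechet_derivative (\<lambda>u'. deriv1 \<psi> u' w) (at u) v"

definition first_form :: "(real^2 \<Rightarrow> real^3) \<Rightarrow> real^2 \<Rightarrow> real^2 \<Rightarrow> real^2 \<Rightarrow> real" where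
  "first_form \<psi> u v w = hyp_metric (\<psi> u) (deriv1 \<psi> u v) (deriv1 \<psi> u w)"

definition unit_normal :: "(real^2 \<Rightarrow> real^3) \<Rightarrow> real^2 \<Rightarrow> real^3 \<Rightarrow> bool" where
  "unit_normal \<psi> u n \<longleftrightarrow>
     hyp_metric (\<psi> u) n n = 1 \<and> (\<forall>v. hyp_metric (\<psi> u) n (deriv1 \<psi> u v) = 0)"

definition second_form ::
    "(real^2 \<Rightarrow> real^3) \<Rightarrow> real^2 \<Rightarrow> real^3 \<Rightarrow> real^2 \<Rightarrow> real^2 \<Rightarrow> real" where
  "second_form \<psi> u n v w = hyp_metric (\<psi> u)
     (deriv2 \<psi> u v w + hyp_christoffel (\<psi> u) (deriv1 \<psi> u v) (deriv1 \<psi> u w)) n"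

definition shape_operator ::
    "(real^2 \<Rightarrow> real^3) \<Rightarrow> real^2 \<Rightarrow> real^3 \<Rightarrow> (real^2 \<Rightarrow> real^2) \<Rightarrow> bool" where
  "shape_operator \<psi> u n L \<longleftrightarrow>
     linear L \<and> (\<forall>v w. first_form \<psi> u (L v) w = second_form \<psi> u n v w)"

text \<open>The principal curvatures are the eigenvalues, with multiplicity, of the shape operator; they
  are listed along an orthonormal basis of eigenvectors. Their product does not depend on the
  choice of the unit normal.\<close>

definition principal_curvatures ::
    "(real^2 \<Rightarrow> real^3) \<Rightarrow> real^2 \<Rightarrow> real \<Rightarrow> real \<Rightarrow> bool" where
  "principal_curvatures \<psi> u k\<^sub>1 k\<^sub>2 \<longleftrightarrow>
     (\<exists>n L e\<^sub>1 e\<^sub>2. unit_normal \<psi> u n \<and> shape_operator \<psi> u n L \<and>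
        first_form \<psi> u e\<^sub>1 e\<^sub>1 = 1 \<and> first_form \<psi> u e\<^sub>2 e\<^sub>2 = 1 \<and> first_form \<psi> u e\<^sub>1 e\<^sub>2 = 0 \<and>
        L e\<^sub>1 = k\<^sub>1 *\<^sub>R e\<^sub>1 \<and> L e\<^sub>2 = k\<^sub>2 *\<^sub>R e\<^sub>2)"

definition area_density :: "(real^2 \<Rightarrow> real^3) \<Rightarrow> real^2 \<Rightarrow> real" where
  "area_density \<psi> u =
     sqrt (det (\<chi> i j. first_form \<psi> u (axis i 1) (axis j 1) :: real^2^2))"


section \<open>Immersed surfaces\<close>

text \<open>The value is the same in all charts around an interior point \<open>p\<close>.\<close>

definition extrinsic_curvature :: "'p chart set \<Rightarrow> ('p \<Rightarrow> real^3) \<Rightarrow> 'p \<Rightarrow> real" where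
  "extrinsic_curvature \<A> f p = (THE k. \<exists>(U, \<phi>)\<in>\<A>. p \<in> U \<and>
     (\<exists>k\<^sub>1 k\<^sub>2. principal_curvatures (in_chart f (U, \<phi>)) (\<phi> p) k\<^sub>1 k\<^sub>2 \<and> k = k\<^sub>1 * k\<^sub>2))"

text \<open>The Borel measure \<open>dS\<close> on the interior whose expression in every chart is the Riemannian
  area element \<open>sqrt (det g\<^sub>i\<^sub>j) du\<^sub>1 du\<^sub>2\<close>. As the surface is second countable, these local
  expressions, which agree on overlaps by the change of variables formula, determine exactly one
  such measure.\<close>

definition hyp_area_measure ::
    "'p topology \<Rightarrow> 'p chart set \<Rightarrow> ('p \<Rightarrow> real^3) \<Rightarrow> 'p measure \<Rightarrow> bool" where
  "hyp_area_measure X \<A> f dS \<longleftrightarrow>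
     space dS = surface_interior X \<A> \<and>
     sets dS = sigma_sets (surface_interior X \<A>)
       {W. openin (subtopology X (surface_interior X \<A>)) W} \<and>
     (\<forall>(U, \<phi>)\<in>\<A>. \<forall>B\<in>sets dS. B \<subseteq> U \<longrightarrow>
        emeasure dS B =
          (\<integral>\<^sup>+u\<in>\<phi> ` B. ennreal (area_density (in_chart f (U, \<phi>)) u) \<partial>lborel))"

definition hyp_length :: "(real \<Rightarrow> real^3) \<Rightarrow> ennreal" where
  "hyp_length c = (\<integral>\<^sup>+t\<in>{0..1}.
     ennreal (sqrt (hyp_metric (c t) (vector_derivative c (at t)) (vector_derivative c (at t))))
     \<partial>lborel)"

text \<open>The Riemannian distance of the induced metric on the interior; it is infinite between
  different components. Since \<open>f\<close> is an immersion, a continuous path in the surface is piecewise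
  \<open>C\<^sup>1\<close> if and only if its image under \<open>f\<close> is.\<close>

definition induced_dist ::
    "'p topology \<Rightarrow> 'p chart set \<Rightarrow> ('p \<Rightarrow> real^3) \<Rightarrow> 'p \<Rightarrow> 'p \<Rightarrow> ennreal" where
  "induced_dist X \<A> f p q = Inf {hyp_length (f \<circ> \<gamma>) | \<gamma>.
     pathin (subtopology X (surface_interior X \<A>)) \<gamma> \<and> \<gamma> 0 = p \<and> \<gamma> 1 = q \<and>
     (f \<circ> \<gamma>) piecewise_C1_differentiable_on {0..1}}"

definition complete_surface :: "'p topology \<Rightarrow> 'p chart set \<Rightarrow> ('p \<Rightarrow> real^3) \<Rightarrow> bool" where
  "complete_surface X \<A> f \<longleftrightarrow>
     (\<forall>s :: nat \<Rightarrow> 'p. range s \<subseteq> surface_interior X \<A> \<and>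
        (\<forall>e>0. \<exists>N. \<forall>m\<ge>N. \<forall>n\<ge>N. induced_dist X \<A> f (s m) (s n) < e) \<longrightarrow>
        (\<exists>p\<in>surface_interior X \<A>. (\<lambda>n. induced_dist X \<A> f (s n) p) \<longlonglongrightarrow> 0))"


section \<open>Cone-like ends\<close>

definition simple_closed_curve :: "(real^3) set \<Rightarrow> bool" where
  "simple_closed_curve C \<longleftrightarrow>
     (\<exists>\<gamma>. simple_path \<gamma> \<and> pathfinish \<gamma> = pathstart \<gamma> \<and> path_image \<gamma> = C)"

text \<open>The plane spanned by the image of \<open>D\<close> is orthogonal to \<open>{x. x $ 3 = 0}\<close>: its normals are
  orthogonal to the normal \<open>axis 3 1\<close> of that plane.\<close>

definition orthogonal_to_ideal_plane :: "(real^2 \<Rightarrow> real^3) \<Rightarrow> bool" where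
  "orthogonal_to_ideal_plane D \<longleftrightarrow> (\<forall>n. (\<forall>v. n \<bullet> D v = 0) \<longrightarrow> n \<bullet> axis 3 1 = 0)"

text \<open>Here \<open>X\<close> with the atlas \<open>\<A>\<close> is the compact surface with boundary, \<open>f\<close> is the extended map,
  and the surface in hyperbolic space is the restriction of \<open>f\<close> to the interior.\<close>

definition cone_like_ends :: "'p topology \<Rightarrow> 'p chart set \<Rightarrow> ('p \<Rightarrow> real^3) \<Rightarrow> bool" where
  "cone_like_ends X \<A> f \<longleftrightarrow>
     C2_surface_with_boundary X \<A> \<and> compact_space X \<and> C2_immersion \<A> f \<and>
     f ` surface_interior X \<A> \<subseteq> half_space \<and>
     f ` surface_boundary X \<A> \<subseteq> {x. x $ 3 = 0} \<and>
     (\<exists>\<C>. finite \<C> \<and> (\<forall>C\<in>\<C>. simple_closed_curve C) \<and> f ` surface_boundary X \<A> = \<Union>\<C>) \<and>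
     (\<forall>(U, \<phi>)\<in>\<A>. \<forall>p\<in>U \<inter> surface_boundary X \<A>. \<forall>D.
        (in_chart f (U, \<phi>) has_derivative D) (at (\<phi> p) within \<phi> ` U) \<longrightarrow>
        orthogonal_to_ideal_plane D)"

definition connected_cone_like_end ::
    "'p topology \<Rightarrow> 'p chart set \<Rightarrow> ('p \<Rightarrow> real^3) \<Rightarrow> (real^3) set \<Rightarrow> bool" where
  "connected_cone_like_end X \<A> f C \<longleftrightarrow>
     cone_like_ends X \<A> f \<and> f ` surface_boundary X \<A> = C \<and> simple_closed_curve C"

end

theory Submission
  imports Defs
begin

text \<open>Let \<open>\<psi>\<close> be a chart expression of \<open>f\<close>, \<open>M = \<psi>\<^sub>1 \<times> \<psi>\<^sub>2\<close>, \<open>h\<close> the height \<open>x\<^sub>3\<close>, \<open>g\<^sub>i\<^sub>j\<close> the Euclidean first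
  fundamental form. The conformal change to the hyperbolic metric gives
  \<open>K = h\<^sup>2 det (\<psi>\<^sub>i\<^sub>j \<bullet> M + g\<^sub>i\<^sub>j M\<^sub>3 / h) / |M|\<^sup>4\<close> and \<open>dS = |M| / h\<^sup>2 du\<close>, so \<open>K dS\<close> is bounded wherever
  \<open>M\<^sub>3 / h\<close> is. Orthogonality to the ideal plane means that \<open>M\<^sub>3\<close> vanishes on the boundary and that
  \<open>h\<close> vanishes there to first order exactly; as \<open>M\<^sub>3\<close> is \<open>C\<^sup>1\<close>, the quotient is bounded up to the
  boundary. Compactness of the surface with boundary finishes the proof.\<close>

section \<open>Maps of class C2 with given derivatives\<close>

text \<open>Why the height vanishes to first order exactly: it is zero along the boundary line, so
  its tangential derivative vanishes there; were the transversal derivative zero as well, the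
  vertical vector would be normal to the tangent plane, which orthogonality forbids. M is itself
  normal to the surface, so orthogonality also kills its vertical component at the boundary. Three
  features of the definitions shape the rest. The curvature is a \<open>THE\<close> over all charts
  and eigenbases, so existence of principal curvatures and independence of the chart come before any
  bound; they need symmetric second derivatives and the chain rule to second order. The measure is
  known only through its values on subsets of chart domains, so integrals are transported by
  push-forward. Chart expressions live on one side of the boundary line, so the estimates are made
  for C2 extensions to full balls, whose derivatives are continuous across that line.\<close>

definition C2_with :: "'a::euclidean_space set \<Rightarrow> ('a \<Rightarrow> 'b::euclidean_space) \<Rightarrow>
    ('a \<Rightarrow> 'a \<Rightarrow>\<^sub>L 'b) \<Rightarrow> ('a \<Rightarrow> 'a \<Rightarrow>\<^sub>L ('a \<Rightarrow>\<^sub>L 'b)) \<Rightarrow> bool" where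
  "C2_with W g g' g'' \<longleftrightarrow> open W \<and>
     (\<forall>x\<in>W. (g has_derivative blinfun_apply (g' x)) (at x)) \<and>
     (\<forall>x\<in>W. (g' has_derivative blinfun_apply (g'' x)) (at x)) \<and>
     continuous_on W g''"

lemma C2_withD:
  assumes "C2_with W g g' g''"
  shows "open W"
    and "x \<in> W \<Longrightarrow> (g has_derivative blinfun_apply (g' x)) (at x)"
    and "x \<in> W \<Longrightarrow> (g' has_derivative blinfun_apply (g'' x)) (at x)"
    and "continuous_on W g''"
  using assms by (auto simp: C2_with_def)

lemma C2_with_subset:
  assumes "C2_with W g g' g''" "open V" "V \<subseteq> W"
  shows "C2_with V g g' g''"
  using assms continuous_on_subset by (auto simp: C2_with_def)

lemma C2_with_continuous:
  assumes "C2_with W g g' g''"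
  shows "continuous_on W g" "continuous_on W g'"
  using has_derivative_continuous[OF C2_withD(2)[OF assms]]
    has_derivative_continuous[OF C2_withD(3)[OF assms]]
  by (auto intro!: continuous_at_imp_continuous_on)

lemma C2_with_has_derivative_apply:
  assumes "C2_with W g g' g''" "x \<in> W"
  shows "((\<lambda>y. g' y w) has_derivative (\<lambda>v. g'' x v w)) (at x)"
  using bounded_linear.has_derivative[OF blinfun.bounded_linear_left C2_withD(3)[OF assms]] .

text \<open>Two uses of the mean value theorem: along \<open>w\<close> for the difference of two
  translates of \<open>g\<close>, then along \<open>v\<close> for \<open>g'\<close>. Pairing with
  \<open>b\<close> makes the functions real-valued, as an exact intermediate point requires.\<close>

lemma second_difference_mean_value:
  fixes g :: "'a::euclidean_space \<Rightarrow> 'b::euclidean_space"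
  assumes C2: "C2_with W g g' g''"
    and W: "\<And>s t. s \<in> {0..1} \<Longrightarrow> t \<in> {0..1} \<Longrightarrow> x + s *\<^sub>R v + t *\<^sub>R w \<in> W"
  obtains s t where "s \<in> {0..1}" "t \<in> {0..1}"
    "(g (x + v + w) - g (x + v) - g (x + w) + g x) \<bullet> b = g'' (x + s *\<^sub>R v + t *\<^sub>R w) v w \<bullet> b"
proof -
  let ?\<phi> = "\<lambda>t. (g (x + v + t *\<^sub>R w) - g (x + t *\<^sub>R w)) \<bullet> b"
  have "\<exists>t\<in>{0..1}. ?\<phi> 1 - ?\<phi> 0 =
      (\<lambda>h. (g' (x + v + t *\<^sub>R w) (h *\<^sub>R w) - g' (x + t *\<^sub>R w) (h *\<^sub>R w)) \<bullet> b) (1 - 0)"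
  proof (rule mvt_very_simple)
    fix t :: real assume t: "0 \<le> t" "t \<le> 1"
    have D: "((\<lambda>t. g (c + t *\<^sub>R w)) has_derivative (\<lambda>h. g' (c + t *\<^sub>R w) (h *\<^sub>R w))) (at t within {0..1})"
      if "c + t *\<^sub>R w \<in> W" for c
      by (rule has_derivative_compose[where g = g])
        (auto intro!: derivative_eq_intros C2_withD(2)[OF C2] that)
    show "(?\<phi> has_derivative (\<lambda>h. (g' (x + v + t *\<^sub>R w) (h *\<^sub>R w) - g' (x + t *\<^sub>R w) (h *\<^sub>R w)) \<bullet> b))
        (at t within {0..1})"
      using W[of 1 t] W[of 0 t] t
      by (intro has_derivative_inner_left has_derivative_diff D) auto
  qed simp
  then obtain t where t: "t \<in> {0..1}"
    "?\<phi> 1 - ?\<phi> 0 = (g' (x + v + t *\<^sub>R w) w - g' (x + t *\<^sub>R w) w) \<bullet> b" by auto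
  let ?\<chi> = "\<lambda>s. g' (x + t *\<^sub>R w + s *\<^sub>R v) w \<bullet> b"
  have "\<exists>s\<in>{0..1}. ?\<chi> 1 - ?\<chi> 0 = (\<lambda>h. g'' (x + t *\<^sub>R w + s *\<^sub>R v) (h *\<^sub>R v) w \<bullet> b) (1 - 0)"
  proof (rule mvt_very_simple)
    fix s :: real assume s: "0 \<le> s" "s \<le> 1"
    have "x + t *\<^sub>R w + s *\<^sub>R v \<in> W" using W[of s t] s t by (simp add: algebra_simps)
    moreover have "((\<lambda>s. x + t *\<^sub>R w + s *\<^sub>R v) has_derivative (\<lambda>h. h *\<^sub>R v)) (at s within {0..1})"
      by (auto intro!: derivative_eq_intros)
    ultimately have "((\<lambda>s. g' (x + t *\<^sub>R w + s *\<^sub>R v) w) has_derivative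
        (\<lambda>h. g'' (x + t *\<^sub>R w + s *\<^sub>R v) (h *\<^sub>R v) w)) (at s within {0..1})"
      using has_derivative_compose C2_with_has_derivative_apply[OF C2] by fast
    then show "(?\<chi> has_derivative (\<lambda>h. g'' (x + t *\<^sub>R w + s *\<^sub>R v) (h *\<^sub>R v) w \<bullet> b)) (at s within {0..1})"
      by (rule has_derivative_inner_left)
  qed simp
  then obtain s where s: "s \<in> {0..1}" "?\<chi> 1 - ?\<chi> 0 = g'' (x + t *\<^sub>R w + s *\<^sub>R v) v w \<bullet> b" by auto
  show thesis
    using s t by (intro that[of s t]) (auto simp: algebra_simps)
qed

text \<open>Schwarz: the second difference is symmetric in its two steps, so up to scaling it is a
  value of either mixed derivative near \<open>x\<close>, and continuity of \<open>g''\<close>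
  merges the two. The symmetry is what makes the second fundamental form diagonalizable.\<close>

lemma C2_with_symmetric:
  fixes g :: "'a::euclidean_space \<Rightarrow> 'b::euclidean_space"
  assumes C2: "C2_with W g g' g''" and x: "x \<in> W"
  shows "g'' x v w = g'' x w v"
proof (rule euclidean_eqI)
  fix b :: 'b
  let ?D = "\<lambda>y. g'' y v w \<bullet> b" and ?E = "\<lambda>y. g'' y w v \<bullet> b"
  have "isCont g'' x" using C2_withD[OF C2] x continuous_on_eq_continuous_at by blast
  then have cont: "isCont ?D x" "isCont ?E x" by (intro continuous_intros; assumption)+
  have "\<bar>?D x - ?E x\<bar> < e" if e: "e > 0" for e
  proof -
    have "eventually (\<lambda>y. y \<in> W \<and> \<bar>?D y - ?D x\<bar> < e / 2 \<and> \<bar>?E y - ?E x\<bar> < e / 2) (nhds x)"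
      using x C2_withD(1)[OF C2] cont[THEN isContD, THEN tendstoD, of "e / 2"] e
      by (intro eventually_conj eventually_nhds_in_open)
        (simp_all add: dist_real_def eventually_nhds_conv_at)
    then obtain d where d: "d > 0" "\<And>y. dist y x < d \<Longrightarrow>
        y \<in> W \<and> \<bar>?D y - ?D x\<bar> < e / 2 \<and> \<bar>?E y - ?E x\<bar> < e / 2"
      by (auto simp: eventually_nhds_metric)
    \<comment> \<open>The parallelogram spanned at \<open>x\<close> by the scaled vectors then stays
      within distance \<open>d / 2\<close>; the summand 1 keeps the denominator positive when both
      vectors vanish.\<close>
    define c where "c = d / (2 * (norm v + norm w + 1))"
    have pos: "norm v + norm w + 1 > 0" by (smt (verit) norm_ge_zero)
    have c: "c > 0" using d pos by (simp add: c_def)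
    have small: "dist (x + s *\<^sub>R c *\<^sub>R v + t *\<^sub>R c *\<^sub>R w) x < d" if "s \<in> {0..1}" "t \<in> {0..1}" for s t
    proof -
      have "norm (s *\<^sub>R c *\<^sub>R v + t *\<^sub>R c *\<^sub>R w) \<le> s * (c * norm v) + t * (c * norm w)"
        using that c by (intro norm_triangle_le) simp
      also have "\<dots> \<le> 1 * (c * norm v) + 1 * (c * norm w)"
        using that c by (intro add_mono mult_right_mono) auto
      also have "\<dots> \<le> c * (norm v + norm w + 1)" using c by (simp add: algebra_simps)
      also have "\<dots> = d / 2" using pos by (simp add: c_def field_simps)
      finally show ?thesis using d by (simp add: dist_norm algebra_simps)
    qed
    obtain s t where st: "s \<in> {0..1}" "t \<in> {0..1}"
      "(g (x + c *\<^sub>R v + c *\<^sub>R w) - g (x + c *\<^sub>R v) - g (x + c *\<^sub>R w) + g x) \<bullet> b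
        = g'' (x + s *\<^sub>R c *\<^sub>R v + t *\<^sub>R c *\<^sub>R w) (c *\<^sub>R v) (c *\<^sub>R w) \<bullet> b"
      using second_difference_mean_value[OF C2, of x "c *\<^sub>R v" "c *\<^sub>R w"] small d by metis
    have small': "dist (x + s *\<^sub>R c *\<^sub>R w + t *\<^sub>R c *\<^sub>R v) x < d" if "s \<in> {0..1}" "t \<in> {0..1}" for s t
      using small[OF that(2,1)] by (simp add: algebra_simps)
    obtain s' t' where st': "s' \<in> {0..1}" "t' \<in> {0..1}"
      "(g (x + c *\<^sub>R w + c *\<^sub>R v) - g (x + c *\<^sub>R w) - g (x + c *\<^sub>R v) + g x) \<bullet> b
        = g'' (x + s' *\<^sub>R c *\<^sub>R w + t' *\<^sub>R c *\<^sub>R v) (c *\<^sub>R w) (c *\<^sub>R v) \<bullet> b"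
      using second_difference_mean_value[OF C2, of x "c *\<^sub>R w" "c *\<^sub>R v"] small' d by metis
    have "c * (c * ?D (x + s *\<^sub>R c *\<^sub>R v + t *\<^sub>R c *\<^sub>R w)) = c * (c * ?E (x + s' *\<^sub>R c *\<^sub>R w + t' *\<^sub>R c *\<^sub>R v))"
      using st(3) st'(3)
      by (simp add: blinfun.scaleR_right blinfun.scaleR_left algebra_simps inner_diff_left inner_add_left)
    then have "?D (x + s *\<^sub>R c *\<^sub>R v + t *\<^sub>R c *\<^sub>R w) = ?E (x + s' *\<^sub>R c *\<^sub>R w + t' *\<^sub>R c *\<^sub>R v)"
      using c by simp
    then show ?thesis
      using d(2)[OF small[OF st(1,2)]] d(2)[OF small'[OF st'(1,2)]] by linarith
  qed
  then show "?D x = ?E x" by (metis abs_le_zero_iff eq_iff_diff_eq_0 linorder_not_le less_irrefl)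
qed

lemma frechet_derivative_C2_with:
  assumes "C2_with W g g' g''" "x \<in> W" "\<And>y. y \<in> W \<Longrightarrow> \<psi> y = g y"
  shows "frechet_derivative \<psi> (at x) = blinfun_apply (g' x)"
proof -
  have "(\<psi> has_derivative blinfun_apply (g' x)) (at x)"
    by (rule has_derivative_transform_within_open[OF C2_withD(2,1)[OF assms(1)]])
      (use assms in auto)
  then show ?thesis using frechet_derivative_at by metis
qed

text \<open>The inner function is itself a \<open>frechet_derivative\<close>, so it has to be
  identified with \<open>g'\<close> on a whole neighbourhood before it can be
  differentiated.\<close>

lemma frechet_derivative2_C2_with:
  assumes "C2_with W g g' g''" "x \<in> W" "\<And>y. y \<in> W \<Longrightarrow> \<psi> y = g y"
  shows "frechet_derivative (\<lambda>y. frechet_derivative \<psi> (at y) w) (at x) v = g'' x v w"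
proof -
  have "((\<lambda>y. frechet_derivative \<psi> (at y) w) has_derivative (\<lambda>v. g'' x v w)) (at x)"
    using frechet_derivative_C2_with[OF assms(1) _ assms(3)] assms(2)
    by (intro has_derivative_transform_within_open[OF
          C2_with_has_derivative_apply[OF assms(1,2)] C2_withD(1)[OF assms(1)]]) auto
  then show ?thesis using frechet_derivative_at by metis
qed

text \<open>The derivatives of all three maps are given, so uniqueness of derivatives turns the
  chain rule into equations between them. The last term of the second equation lies in the image of
  \<open>g' (\<tau> x)\<close>: it is tangential and will drop out against the normal.\<close>

lemma C2_with_compose:
  fixes g :: "'b::euclidean_space \<Rightarrow> 'c::euclidean_space" and \<tau> :: "'a::euclidean_space \<Rightarrow> 'b"
  assumes g: "C2_with V g g' g''" and \<tau>: "C2_with W \<tau> \<tau>' \<tau>''" and "\<tau> ` W \<subseteq> V" and x: "x \<in> W"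
    and eq: "\<And>y. y \<in> W \<Longrightarrow> h y = g (\<tau> y)" and h: "C2_with W h h' h''"
  shows "h' x v = g' (\<tau> x) (\<tau>' x v)"
    and "h'' x v w = g'' (\<tau> x) (\<tau>' x v) (\<tau>' x w) + g' (\<tau> x) (\<tau>'' x v w)"
proof -
  have 1: "h' y w = g' (\<tau> y) (\<tau>' y w)" if y: "y \<in> W" for y w
  proof -
    have "((\<lambda>y. g (\<tau> y)) has_derivative (\<lambda>v. g' (\<tau> y) (\<tau>' y v))) (at y)"
      using assms y by (intro has_derivative_compose[OF C2_withD(2)[OF \<tau>]] C2_withD(2)[OF g]) auto
    then have "(h has_derivative (\<lambda>v. g' (\<tau> y) (\<tau>' y v))) (at y)"
      by (rule has_derivative_transform_within_open[OF _ C2_withD(1)[OF \<tau>] y]) (simp add: eq)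
    then show ?thesis using C2_withD(2)[OF h y] has_derivative_unique by metis
  qed
  then show "h' x v = g' (\<tau> x) (\<tau>' x v)" using x .
  have "((\<lambda>y. g' (\<tau> y)) has_derivative (\<lambda>v. g'' (\<tau> x) (\<tau>' x v))) (at x)"
    using assms by (intro has_derivative_compose[OF C2_withD(2)[OF \<tau>]] C2_withD(3)[OF g]) auto
  from blinfun.FDERIV[OF this C2_with_has_derivative_apply[OF \<tau> x, of w]]
  have "((\<lambda>y. h' y w) has_derivative
      (\<lambda>v. g' (\<tau> x) (\<tau>'' x v w) + g'' (\<tau> x) (\<tau>' x v) (\<tau>' x w))) (at x)"
    by (rule has_derivative_transform_within_open[OF _ C2_withD(1)[OF \<tau>] x]) (simp add: 1)
  then show "h'' x v w = g'' (\<tau> x) (\<tau>' x v) (\<tau>' x w) + g' (\<tau> x) (\<tau>'' x v w)"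
    using C2_with_has_derivative_apply[OF h x, of w] has_derivative_unique
    by (metis (no_types, lifting) add.commute)
qed

section \<open>Pointwise formulas for the extrinsic curvature\<close>

unbundle cross3_syntax

section \<open>Determinants, cross products and normals on a tangent plane\<close>

definition det2 :: "real^2 \<Rightarrow> real^2 \<Rightarrow> real" where
  "det2 v w = v $ 1 * w $ 2 - v $ 2 * w $ 1"

text \<open>The Gram determinant of \<open>B\<close> on a pair of vectors. The product
  \<open>B v w * B w v\<close> in place of a square makes its scaling law hold without
  symmetry.\<close>

definition form_det :: "(real^2 \<Rightarrow> real^2 \<Rightarrow> real) \<Rightarrow> real^2 \<Rightarrow> real^2 \<Rightarrow> real" where
  "form_det B v w = B v v * B w w - B v w * B w v"

lemma vec2_expand: "(v::real^2) = v $ 1 *\<^sub>R axis 1 1 + v $ 2 *\<^sub>R axis 2 1"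
  by (simp add: vec_eq_iff forall_2 axis_def)

lemma linear_expand2:
  fixes P :: "real^2 \<Rightarrow> 'a::real_vector"
  assumes "linear P"
  shows "P v = v $ 1 *\<^sub>R P (axis 1 1) + v $ 2 *\<^sub>R P (axis 2 1)"
  using arg_cong[OF vec2_expand[of v], of P] by (simp add: linear_add[OF assms] linear_scale[OF assms])

lemma bilinear_expand2:
  fixes B :: "real^2 \<Rightarrow> real^2 \<Rightarrow> 'a::real_vector"
  assumes "bilinear B"
  shows "B v w = (v $ 1 * w $ 1) *\<^sub>R B (axis 1 1) (axis 1 1) + (v $ 1 * w $ 2) *\<^sub>R B (axis 1 1) (axis 2 1)
    + (v $ 2 * w $ 1) *\<^sub>R B (axis 2 1) (axis 1 1) + (v $ 2 * w $ 2) *\<^sub>R B (axis 2 1) (axis 2 1)"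
proof -
  have "B v w = B (v $ 1 *\<^sub>R axis 1 1 + v $ 2 *\<^sub>R axis 2 1) (w $ 1 *\<^sub>R axis 1 1 + w $ 2 *\<^sub>R axis 2 1)"
    by (rule arg_cong2[OF vec2_expand vec2_expand])
  then show ?thesis
    by (simp add: bilinear_ladd[OF assms] bilinear_radd[OF assms] bilinear_lmul[OF assms]
        bilinear_rmul[OF assms] algebra_simps)
qed

text \<open>Congruence of matrices multiplies the determinant by the square of that of the base
  change. This lets a curvature computed in an eigenbasis be read off in the coordinate
  basis.\<close>

lemma form_det_eq_det2:
  assumes "bilinear B"
  shows "form_det B v w = (det2 v w)\<^sup>2 * form_det B (axis 1 1) (axis 2 1)"
  unfolding form_det_def det2_def bilinear_expand2[OF assms, of v v] bilinear_expand2[OF assms, of w w]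
    bilinear_expand2[OF assms, of v w] bilinear_expand2[OF assms, of w v]
  by (simp add: power2_eq_square algebra_simps)

text \<open>Left unnormalised: it is polynomial in \<open>P\<close>, hence as smooth as the first
  derivatives, and its squared length is the determinant of the Euclidean first fundamental
  form.\<close>

definition normal_vec :: "(real^2 \<Rightarrow> real^3) \<Rightarrow> real^3" where
  "normal_vec P = P (axis 1 1) \<times> P (axis 2 1)"

lemma normal_vec_orthogonal:
  assumes "linear P"
  shows "normal_vec P \<bullet> P v = 0"
  by (subst linear_expand2[OF assms]) (simp add: normal_vec_def inner_add_right dot_cross_self inner_commute)

lemma cross_linear2:
  assumes "linear P"
  shows "P v \<times> P w = det2 v w *\<^sub>R normal_vec P"
proof -
  have "P v \<times> P w = (v $ 1 *\<^sub>R P (axis 1 1) + v $ 2 *\<^sub>R P (axis 2 1)) \<times>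
      (w $ 1 *\<^sub>R P (axis 1 1) + w $ 2 *\<^sub>R P (axis 2 1))"
    using linear_expand2[OF assms, of v] linear_expand2[OF assms, of w] by simp
  then show ?thesis
    using cross_skew[of "P (axis 2 1)" "P (axis 1 1)"]
    by (simp add: cross_add_left cross_add_right cross_mult_left cross_mult_right det2_def
        normal_vec_def algebra_simps)
qed

text \<open>A vanishing cross product means equality in Cauchy-Schwarz, by Lagrange's identity. The
  second column minus its projection \<open>c *\<^sub>R ?a\<close> onto the first is then zero,
  against injectivity.\<close>

lemma normal_vec_nonzero:
  assumes "linear P" "inj P"
  shows "normal_vec P \<noteq> 0"
proof
  assume 0: "normal_vec P = 0"
  then have *: "P v \<times> P w = 0" for v w by (simp add: cross_linear2[OF assms(1)])
  let ?a = "P (axis 1 1)" and ?b = "P (axis 2 1)"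
  have ab: "(?a \<bullet> ?b) * (?a \<bullet> ?b) = (?a \<bullet> ?a) * (?b \<bullet> ?b)"
    using norm_cross_dot[of ?a ?b] * by (simp add: power_mult_distrib power2_norm_eq_inner) (simp add: power2_eq_square)
  have a0: "?a \<noteq> 0"
    using assms by (metis axis_eq_0_iff linear_injective_0 zero_neq_one)
  define c where "c = (?a \<bullet> ?b) / (?a \<bullet> ?a)"
  have "c * (?a \<bullet> ?b) = ((?a \<bullet> ?b) * (?a \<bullet> ?b)) / (?a \<bullet> ?a)" by (simp add: c_def)
  then have c: "c * (?a \<bullet> ?a) = ?a \<bullet> ?b" "c * (?a \<bullet> ?b) = ?b \<bullet> ?b"
    using a0 unfolding ab by (simp_all add: c_def)
  have "(?b - c *\<^sub>R ?a) \<bullet> (?b - c *\<^sub>R ?a) = 0"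
    using c by (simp add: inner_diff_left inner_diff_right inner_commute)
  then have "P (axis 2 1 - c *\<^sub>R axis 1 1) = 0"
    by (simp add: linear_diff[OF assms(1)] linear_scale[OF assms(1)])
  then have "axis 2 1 - c *\<^sub>R axis 1 1 = (0 :: real^2)"
    using assms by (metis linear_injective_0)
  then have "(axis 2 1 - c *\<^sub>R axis 1 1 :: real^2) $ 2 = 0" by simp
  then show False by (simp add: axis_def)
qed

text \<open>The part \<open>d\<close> of \<open>n\<close> orthogonal to the normal is orthogonal to
  the tangent plane too; the triple product expansion gives \<open>d \<times> ?M = 0\<close>, and
  Lagrange's identity then forces \<open>d = 0\<close>.\<close>

lemma normal_unique:
  assumes "linear P" "normal_vec P \<noteq> 0" "\<And>v. n \<bullet> P v = 0"
  obtains s where "n = s *\<^sub>R normal_vec P"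
proof -
  let ?M = "normal_vec P"
  define d where "d = n - ((n \<bullet> ?M) / (?M \<bullet> ?M)) *\<^sub>R ?M"
  have "d \<bullet> P v = 0" for v
    using assms(3) normal_vec_orthogonal[OF assms(1)] by (simp add: d_def inner_diff_left)
  moreover have "d \<bullet> ?M = 0" using assms(2) by (simp add: d_def inner_diff_left)
  ultimately have "d \<bullet> P (axis 1 1) = 0" "d \<bullet> P (axis 2 1) = 0" "d \<bullet> normal_vec P = 0" by auto
  moreover have "(d \<bullet> d) * (?M \<bullet> ?M) = (d \<bullet> ?M)\<^sup>2 + (norm (d \<times> ?M))\<^sup>2"
    using norm_cross_dot[of d ?M] by (simp add: power_mult_distrib power2_norm_eq_inner)
  moreover have "d \<times> ?M = (d \<bullet> P (axis 2 1)) *\<^sub>R P (axis 1 1) - (d \<bullet> P (axis 1 1)) *\<^sub>R P (axis 2 1)"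
    unfolding normal_vec_def by (simp add: cross3_simps forall_3)
  ultimately have "(d \<bullet> d) * (?M \<bullet> ?M) = 0" by simp
  then have "d = 0" using assms(2) by simp
  then show thesis using that by (simp add: d_def)
qed

text \<open>For a parametrisation with differential \<open>P\<close> and second differential \<open>H\<close> at height \<open>h\<close>, the
  hyperbolic second fundamental form for the normal \<open>s *\<^sub>R normal_vec P\<close> is \<open>s / h\<^sup>2\<close> times the form
  below. The second summand comes from the Christoffel symbols; it is the only one that could blow
  up at \<open>h = 0\<close>.\<close>

definition scaled_second_form ::
    "real \<Rightarrow> (real^2 \<Rightarrow> real^3) \<Rightarrow> (real^2 \<Rightarrow> real^2 \<Rightarrow> real^3) \<Rightarrow> real^2 \<Rightarrow> real^2 \<Rightarrow> real" where
  "scaled_second_form h P H v w = H v w \<bullet> normal_vec P + (P v \<bullet> P w) * (normal_vec P $ 3 / h)"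

text \<open>The quotient of the Gram determinants of the second and first fundamental forms: with
  \<open>q\<close> the form above and M the normal, \<open>(s / h^2)^2 * det q\<close> over
  \<open>|M|^2 / h^4\<close>, where \<open>s^2 = h^2 / |M|^2\<close> for a unit normal.\<close>

definition curvature_formula ::
    "real \<Rightarrow> (real^2 \<Rightarrow> real^3) \<Rightarrow> (real^2 \<Rightarrow> real^2 \<Rightarrow> real^3) \<Rightarrow> real" where
  "curvature_formula h P H = h\<^sup>2 * form_det (scaled_second_form h P H) (axis 1 1) (axis 2 1)
     / (normal_vec P \<bullet> normal_vec P)\<^sup>2"

lemma bilinear_inner_linear:
  assumes "linear P" shows "bilinear (\<lambda>v w. P v \<bullet> P w)"
  unfolding bilinear_def
  by (auto intro!: linearI simp: linear_add[OF assms] linear_scale[OF assms] inner_add_left inner_add_right)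

lemma bilinear_scaled_second_form:
  assumes "linear P" "bilinear H"
  shows "bilinear (scaled_second_form h P H)"
  unfolding bilinear_def scaled_second_form_def
  by (auto intro!: linearI simp: linear_add[OF assms(1)] linear_scale[OF assms(1)] inner_add_left
      inner_add_right bilinear_ladd[OF assms(2)] bilinear_radd[OF assms(2)] bilinear_lmul[OF assms(2)]
      bilinear_rmul[OF assms(2)] algebra_simps add_divide_distrib)

lemma form_det_inner:
  "form_det (\<lambda>v w. P v \<bullet> P w) (axis 1 1) (axis 2 1) = normal_vec P \<bullet> normal_vec P"
  using norm_cross_dot[of "P (axis 1 1)" "P (axis 2 1)"]
  unfolding power_mult_distrib power2_norm_eq_inner
  by (simp add: form_det_def normal_vec_def power2_eq_square inner_commute)

lemma form_det_scale: "form_det (\<lambda>v w. c * B v w) v w = c\<^sup>2 * form_det B v w"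
  by (simp add: form_det_def power2_eq_square algebra_simps)

text \<open>The summand \<open>P (R v w)\<close> is tangential, so the normal annihilates it. The
  normal itself picks up the factor \<open>d\<close>, so the Gram determinant gains
  \<open>d^2\<close> from the normal and \<open>d^2\<close> from the base change; the fourth power
  of the normal's length in the denominator gains the same.\<close>

lemma curvature_formula_change_of_coordinates:
  assumes P: "linear P" "bilinear H" and T: "linear T"
    and P': "\<And>v. P' v = P (T v)" and H': "\<And>v w. H' v w = H (T v) (T w) + P (R v w)"
    and nz: "normal_vec P' \<noteq> 0"
  shows "curvature_formula h P' H' = curvature_formula h P H"
proof -
  define d where "d = det2 (T (axis 1 1)) (T (axis 2 1))"
  have M: "normal_vec P' = d *\<^sub>R normal_vec P"
    unfolding normal_vec_def[of P'] P' d_def by (rule cross_linear2[OF P(1)])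
  then have d: "d \<noteq> 0" and "normal_vec P \<noteq> 0" using nz by auto
  have "scaled_second_form h P' H' v w = d * scaled_second_form h P H (T v) (T w)" for v w
    using normal_vec_orthogonal[OF P(1)]
    by (simp add: scaled_second_form_def M H' P' inner_add_left algebra_simps inner_commute[of "P _" "normal_vec P"])
  then have "form_det (scaled_second_form h P' H') (axis 1 1) (axis 2 1)
      = d\<^sup>2 * form_det (scaled_second_form h P H) (T (axis 1 1)) (T (axis 2 1))"
    by (simp add: form_det_def power2_eq_square algebra_simps)
  also have "\<dots> = d^4 * form_det (scaled_second_form h P H) (axis 1 1) (axis 2 1)"
    by (subst form_det_eq_det2[OF bilinear_scaled_second_form[OF P]]) (simp add: d_def power2_eq_square power4_eq_xxxx)
  finally show ?thesis
    using d \<open>normal_vec P \<noteq> 0\<close>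
    by (simp add: curvature_formula_def M power2_eq_square power4_eq_xxxx)
qed

text \<open>An orthonormal basis is rotated by half the argument of \<open>(B a a - B b b) / 2 + \<i> B a b\<close>.\<close>

lemma diagonalize2:
  fixes I B :: "real^2 \<Rightarrow> real^2 \<Rightarrow> real"
  assumes I: "bilinear I" "\<And>v w. I v w = I w v" "\<And>v. v \<noteq> 0 \<Longrightarrow> I v v > 0"
    and B: "bilinear B" "\<And>v w. B v w = B w v"
  obtains e\<^sub>1 e\<^sub>2 where "I e\<^sub>1 e\<^sub>1 = 1" "I e\<^sub>2 e\<^sub>2 = 1" "I e\<^sub>1 e\<^sub>2 = 0" "B e\<^sub>1 e\<^sub>2 = 0"
proof -
  note bl = bilinear_ladd bilinear_radd bilinear_lmul bilinear_rmul bilinear_lsub bilinear_rsub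
  have normalize: "I ((1 / sqrt (I v v)) *\<^sub>R v) ((1 / sqrt (I v v)) *\<^sub>R v) = 1" if "v \<noteq> 0" for v
    using I(3)[OF that] by (simp add: bl[OF I(1)] field_simps)
  \<comment> \<open>Gram-Schmidt on the coordinate axes. As \<open>a\<close> is a multiple of the
    first axis, the second coordinate of \<open>c\<close> stays 1, so \<open>c\<close> is
    nonzero.\<close>
  define a :: "real^2" where "a = (1 / sqrt (I (axis 1 1) (axis 1 1))) *\<^sub>R axis 1 1"
  have a: "I a a = 1" unfolding a_def by (rule normalize) (simp add: axis_eq_0_iff)
  define c where "c = axis 2 1 - I a (axis 2 1) *\<^sub>R a"
  have ac: "I a c = 0" by (simp add: c_def bl[OF I(1)] a)
  have "c $ 2 = 1" by (simp add: c_def a_def axis_def)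
  then have c: "c \<noteq> 0" by auto
  define b where "b = (1 / sqrt (I c c)) *\<^sub>R c"
  have b: "I b b = 1" unfolding b_def using c by (rule normalize)
  have ab: "I a b = 0" by (simp add: b_def bl[OF I(1)] ac)
  have ba: "I b a = 0" using ab I(2) by metis
  \<comment> \<open>In the basis rotated by \<open>t\<close>, the mixed entry of \<open>B\<close> is
    the imaginary part of \<open>z\<close> times \<open>cis (- 2 * t)\<close>, so it vanishes for
    \<open>2 * t = Arg z\<close>; if \<open>z = 0\<close>, any angle would do.\<close>
  define z where "z = Complex ((B a a - B b b) / 2) (B a b)"
  define t where "t = Arg z / 2"
  have z: "(B a a - B b b) / 2 = cmod z * cos (2 * t)" "B a b = cmod z * sin (2 * t)"
    using arg_cong[OF rcis_cmod_Arg[of z], of Re] arg_cong[OF rcis_cmod_Arg[of z], of Im]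
    by (simp_all add: z_def t_def)
  let ?e = "cos t *\<^sub>R a + sin t *\<^sub>R b" and ?f = "(- sin t) *\<^sub>R a + cos t *\<^sub>R b"
  have sc: "sin t * sin t + cos t * cos t = 1" "cos t * cos t + sin t * sin t = 1"
    by (metis power2_eq_square sin_cos_squared_add, metis power2_eq_square sin_cos_squared_add2)
  have "B ?e ?f = B a b * (cos t * cos t - sin t * sin t) - ((B a a - B b b) / 2) * (2 * (sin t * cos t))"
    by (simp add: bl[OF B(1)] B(2)[of b a] field_simps)
  also have "\<dots> = B a b * cos (2 * t) - ((B a a - B b b) / 2) * sin (2 * t)"
    unfolding cos_double sin_double power2_eq_square by (simp only: mult.assoc)
  also have "\<dots> = 0" unfolding z by simp
  finally have "B ?e ?f = 0" .
  moreover have "I ?e ?e = 1" "I ?f ?f = 1" "I ?e ?f = 0"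
    using a b ab ba sc by (simp_all add: bl[OF I(1)])
  ultimately show thesis using that by blast
qed

text \<open>Orthonormality makes the Gram determinant 1, so \<open>det2\<close> is nonzero on the
  pair and Cramer's rule expands \<open>v\<close>; pairing with the basis identifies the
  coefficients.\<close>

lemma orthonormal_expand2:
  fixes I :: "real^2 \<Rightarrow> real^2 \<Rightarrow> real"
  assumes I: "bilinear I" "\<And>v w. I v w = I w v" "\<And>v. v \<noteq> 0 \<Longrightarrow> I v v > 0"
    and e: "I e\<^sub>1 e\<^sub>1 = 1" "I e\<^sub>2 e\<^sub>2 = 1" "I e\<^sub>1 e\<^sub>2 = 0"
  shows "v = I v e\<^sub>1 *\<^sub>R e\<^sub>1 + I v e\<^sub>2 *\<^sub>R e\<^sub>2"
proof -
  note bl = bilinear_ladd[OF I(1)] bilinear_radd[OF I(1)] bilinear_lmul[OF I(1)] bilinear_rmul[OF I(1)]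
    bilinear_lsub[OF I(1)] bilinear_rsub[OF I(1)] bilinear_lzero[OF I(1)] bilinear_rzero[OF I(1)]
  have "form_det I e\<^sub>1 e\<^sub>2 = 1" using e I(2)[of e\<^sub>2 e\<^sub>1] by (simp add: form_det_def)
  then have det: "det2 e\<^sub>1 e\<^sub>2 \<noteq> 0" using form_det_eq_det2[OF I(1), of e\<^sub>1 e\<^sub>2] by auto
  define a b where "a = det2 v e\<^sub>2 / det2 e\<^sub>1 e\<^sub>2" and "b = det2 e\<^sub>1 v / det2 e\<^sub>1 e\<^sub>2"
  have v: "v = a *\<^sub>R e\<^sub>1 + b *\<^sub>R e\<^sub>2"
    using det by (simp add: vec_eq_iff forall_2 a_def b_def field_simps) (simp add: det2_def algebra_simps)
  have "I v e\<^sub>1 = a" "I v e\<^sub>2 = b"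
    using e I(2)[of e\<^sub>2 e\<^sub>1] by (simp_all add: v bl)
  then show ?thesis using v by simp
qed

section \<open>Hyperbolic fundamental forms and principal curvatures at one point\<close>

text \<open>\<open>P\<close> and \<open>H\<close> stand in for the derivatives of
  \<open>\<psi>\<close> so that they can be instantiated with those of a C2 extension, which remain
  meaningful and continuous up to the boundary.\<close>

locale immersed_point =
  fixes \<psi> :: "real^2 \<Rightarrow> real^3" and u :: "real^2"
    and P :: "real^2 \<Rightarrow> real^3" and H :: "real^2 \<Rightarrow> real^2 \<Rightarrow> real^3"
  assumes deriv1: "\<And>v. deriv1 \<psi> u v = P v" and deriv2: "\<And>v w. deriv2 \<psi> u v w = H v w"
    and lin: "linear P" and bil: "bilinear H" and sym: "\<And>v w. H v w = H w v"
    and nz: "normal_vec P \<noteq> 0" and pos: "\<psi> u $ 3 > 0"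
begin

lemma first_form_eq: "first_form \<psi> u v w = (P v \<bullet> P w) / (\<psi> u $ 3)\<^sup>2"
  by (simp add: first_form_def hyp_metric_def deriv1)

lemma area_density_eq: "area_density \<psi> u = norm (normal_vec P) / (\<psi> u $ 3)\<^sup>2"
proof -
  have "det (\<chi> i j. first_form \<psi> u (axis i 1) (axis j 1) :: real^2^2)
      = form_det (\<lambda>v w. (1 / (\<psi> u $ 3)\<^sup>2) * (P v \<bullet> P w)) (axis 1 1) (axis 2 1)"
    by (simp add: det_2 form_det_def first_form_eq)
  also have "\<dots> = (norm (normal_vec P) / (\<psi> u $ 3)\<^sup>2)\<^sup>2"
    unfolding form_det_scale form_det_inner by (simp add: power_divide power2_norm_eq_inner)
  finally show ?thesis by (simp add: area_density_def)
qed

text \<open>Of the three Christoffel terms, two are multiples of tangent vectors and vanish against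
  the normal; the vertical one leaves the inner product of the tangent vectors times the vertical
  component of the normal over the height.\<close>

lemma second_form_eq:
  assumes "n = s *\<^sub>R normal_vec P"
  shows "second_form \<psi> u n v w = (s / (\<psi> u $ 3)\<^sup>2) * scaled_second_form (\<psi> u $ 3) P H v w"
proof -
  have "P v \<bullet> normal_vec P = 0" for v using normal_vec_orthogonal[OF lin] by (simp add: inner_commute)
  then show ?thesis using pos
    by (simp add: second_form_def deriv1 deriv2 hyp_metric_def hyp_christoffel_def assms scaled_second_form_def
        inner_add_left inner_diff_left inner_axis' field_simps)
qed

lemma unit_normal_iff:
  "unit_normal \<psi> u n \<longleftrightarrow> (\<exists>s. n = s *\<^sub>R normal_vec P \<and> s\<^sup>2 * (normal_vec P \<bullet> normal_vec P) = (\<psi> u $ 3)\<^sup>2)"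
proof
  assume n: "unit_normal \<psi> u n"
  then have "n \<bullet> P v = 0" for v using pos by (auto simp: unit_normal_def hyp_metric_def deriv1)
  then obtain s where s: "n = s *\<^sub>R normal_vec P" using normal_unique[OF lin nz] by blast
  moreover have "n \<bullet> n = (\<psi> u $ 3)\<^sup>2" using n pos by (simp add: unit_normal_def hyp_metric_def)
  ultimately show "\<exists>s. n = s *\<^sub>R normal_vec P \<and> s\<^sup>2 * (normal_vec P \<bullet> normal_vec P) = (\<psi> u $ 3)\<^sup>2"
    by (intro exI[of _ s]) (simp add: power2_eq_square mult.assoc)
next
  assume "\<exists>s. n = s *\<^sub>R normal_vec P \<and> s\<^sup>2 * (normal_vec P \<bullet> normal_vec P) = (\<psi> u $ 3)\<^sup>2"
  then show "unit_normal \<psi> u n"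
    using pos normal_vec_orthogonal[OF lin]
    by (auto simp: unit_normal_def hyp_metric_def deriv1 power2_eq_square mult.assoc)
qed

lemma bilinear_first_form: "bilinear (first_form \<psi> u)"
  using bilinear_inner_linear[OF lin]
  unfolding bilinear_def first_form_eq linear_iff by (simp add: add_divide_distrib)

lemma bilinear_second_form:
  assumes "n = s *\<^sub>R normal_vec P" shows "bilinear (second_form \<psi> u n)"
  using bilinear_scaled_second_form[OF lin bil, of "\<psi> u $ 3"]
  unfolding bilinear_def second_form_eq[OF assms] linear_iff
  by (simp add: add_divide_distrib distrib_left)

text \<open>In an orthonormal eigenbasis the Gram determinant of the second form is the product and
  that of the first form is 1. Passing to coordinate axes multiplies both by the same factor, which
  the first form determines. Only \<open>s^2\<close> enters, so the sign of the normal is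
  immaterial.\<close>

lemma principal_curvatures_product:
  assumes "principal_curvatures \<psi> u k\<^sub>1 k\<^sub>2"
  shows "k\<^sub>1 * k\<^sub>2 = curvature_formula (\<psi> u $ 3) P H"
proof -
  let ?h = "\<psi> u $ 3" and ?M2 = "normal_vec P \<bullet> normal_vec P"
  obtain n L e\<^sub>1 e\<^sub>2 where *: "unit_normal \<psi> u n" "shape_operator \<psi> u n L"
    "first_form \<psi> u e\<^sub>1 e\<^sub>1 = 1" "first_form \<psi> u e\<^sub>2 e\<^sub>2 = 1" "first_form \<psi> u e\<^sub>1 e\<^sub>2 = 0"
    "L e\<^sub>1 = k\<^sub>1 *\<^sub>R e\<^sub>1" "L e\<^sub>2 = k\<^sub>2 *\<^sub>R e\<^sub>2"
    using assms by (auto simp: principal_curvatures_def)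
  obtain s where s: "n = s *\<^sub>R normal_vec P" "s\<^sup>2 * ?M2 = ?h\<^sup>2"
    using *(1) unit_normal_iff by auto
  have II: "second_form \<psi> u n v w = first_form \<psi> u (L v) w" for v w
    using *(2) by (simp add: shape_operator_def)
  note l = bilinear_lmul[OF bilinear_first_form]
  have 21: "first_form \<psi> u e\<^sub>2 e\<^sub>1 = 0" using *(5) by (simp add: first_form_def hyp_metric_def inner_commute)
  have "k\<^sub>1 * k\<^sub>2 = form_det (second_form \<psi> u n) e\<^sub>1 e\<^sub>2"
    by (simp add: form_det_def II * l 21)
  also have "\<dots> = (det2 e\<^sub>1 e\<^sub>2)\<^sup>2 * form_det (second_form \<psi> u n) (axis 1 1) (axis 2 1)"
    by (rule form_det_eq_det2[OF bilinear_second_form[OF s(1)]])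
  also have "form_det (second_form \<psi> u n) (axis 1 1) (axis 2 1)
      = (s / ?h\<^sup>2)\<^sup>2 * form_det (scaled_second_form ?h P H) (axis 1 1) (axis 2 1)"
    unfolding form_det_scale[symmetric] by (simp add: second_form_eq[OF s(1)] form_det_def)
  finally have k: "k\<^sub>1 * k\<^sub>2 = (det2 e\<^sub>1 e\<^sub>2)\<^sup>2 * ((s / ?h\<^sup>2)\<^sup>2 * form_det (scaled_second_form ?h P H) (axis 1 1) (axis 2 1))" .
  have "1 = form_det (first_form \<psi> u) e\<^sub>1 e\<^sub>2" by (simp add: form_det_def * 21)
  also have "\<dots> = (det2 e\<^sub>1 e\<^sub>2)\<^sup>2 * form_det (first_form \<psi> u) (axis 1 1) (axis 2 1)"
    by (rule form_det_eq_det2[OF bilinear_first_form])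
  also have "form_det (first_form \<psi> u) (axis 1 1) (axis 2 1) = (1 / ?h\<^sup>2)\<^sup>2 * ?M2"
    unfolding form_det_inner[symmetric] form_det_scale[symmetric] by (simp add: first_form_eq form_det_def)
  finally have d: "(det2 e\<^sub>1 e\<^sub>2)\<^sup>2 = (?h\<^sup>2)\<^sup>2 / ?M2"
    using pos nz by (simp add: field_simps)
  have s2: "s\<^sup>2 = ?h\<^sup>2 / ?M2" using s(2) nz by (simp add: field_simps)
  show ?thesis
    unfolding k d power_divide s2 curvature_formula_def using pos nz
    by (simp add: field_simps power2_eq_square)
qed

text \<open>Without existence the \<open>THE\<close> in \<open>extrinsic_curvature\<close> would be
  unspecified. Diagonalizing both fundamental forms at once provides the eigenbasis.\<close>

lemma principal_curvatures_exist: "\<exists>k\<^sub>1 k\<^sub>2. principal_curvatures \<psi> u k\<^sub>1 k\<^sub>2"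
proof -
  let ?I = "first_form \<psi> u"
  define s where "s = \<psi> u $ 3 / norm (normal_vec P)"
  define n where "n = s *\<^sub>R normal_vec P"
  let ?B = "second_form \<psi> u n"
  have "s\<^sup>2 * (normal_vec P \<bullet> normal_vec P) = (\<psi> u $ 3)\<^sup>2"
    using nz by (simp add: s_def power_divide power2_norm_eq_inner)
  then have n: "unit_normal \<psi> u n" using unit_normal_iff n_def by blast
  have I: "bilinear ?I" "\<And>v w. ?I v w = ?I w v"
    using bilinear_first_form by (auto simp: first_form_eq inner_commute)
  have Ipos: "?I v v > 0" if "v \<noteq> 0" for v
  proof -
    have "P v \<noteq> 0"
    proof
      assume 0: "P v = 0"
      then have "det2 v w *\<^sub>R normal_vec P = 0" for w using cross_linear2[OF lin, of v w] by simp
      then have "det2 v (axis 1 1) = 0" "det2 v (axis 2 1) = 0" using nz by auto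
      then show False using that by (simp add: det2_def axis_def vec_eq_iff forall_2)
    qed
    then show ?thesis using pos by (simp add: first_form_eq)
  qed
  have B: "bilinear ?B" "\<And>v w. ?B v w = ?B w v"
    using bilinear_second_form[OF n_def] sym
    by (auto simp: second_form_eq[OF n_def] scaled_second_form_def inner_commute)
  obtain e\<^sub>1 e\<^sub>2 where e: "?I e\<^sub>1 e\<^sub>1 = 1" "?I e\<^sub>2 e\<^sub>2 = 1" "?I e\<^sub>1 e\<^sub>2 = 0" "?B e\<^sub>1 e\<^sub>2 = 0"
    using diagonalize2[OF I Ipos B] by metis
  note ex = orthonormal_expand2[OF I Ipos e(1-3)]
  \<comment> \<open>The operator that is diagonal in the basis found, with the diagonal entries of
    the second form as eigenvalues.\<close>
  define L where "L v = (?B e\<^sub>1 e\<^sub>1 * ?I v e\<^sub>1) *\<^sub>R e\<^sub>1 + (?B e\<^sub>2 e\<^sub>2 * ?I v e\<^sub>2) *\<^sub>R e\<^sub>2" for v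
  note bI = bilinear_ladd[OF I(1)] bilinear_radd[OF I(1)] bilinear_lmul[OF I(1)] bilinear_rmul[OF I(1)]
  note bB = bilinear_ladd[OF B(1)] bilinear_radd[OF B(1)] bilinear_lmul[OF B(1)] bilinear_rmul[OF B(1)]
  have "linear L" by (rule linearI) (simp_all add: L_def bI algebra_simps)
  moreover have "?I (L v) w = ?B v w" for v w
  proof -
    have "?B v w = ?B (?I v e\<^sub>1 *\<^sub>R e\<^sub>1 + ?I v e\<^sub>2 *\<^sub>R e\<^sub>2) (?I w e\<^sub>1 *\<^sub>R e\<^sub>1 + ?I w e\<^sub>2 *\<^sub>R e\<^sub>2)"
      using ex by metis
    also have "\<dots> = ?I v e\<^sub>1 * (?I w e\<^sub>1 * ?B e\<^sub>1 e\<^sub>1) + ?I v e\<^sub>2 * (?I w e\<^sub>2 * ?B e\<^sub>2 e\<^sub>2)"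
      using e(4) B(2)[of e\<^sub>2 e\<^sub>1] by (simp add: bB)
    finally show ?thesis
      by (simp add: L_def bI I(2)[of e\<^sub>1 w] I(2)[of e\<^sub>2 w])
  qed
  ultimately have "shape_operator \<psi> u n L" by (simp add: shape_operator_def)
  moreover have "L e\<^sub>1 = ?B e\<^sub>1 e\<^sub>1 *\<^sub>R e\<^sub>1" "L e\<^sub>2 = ?B e\<^sub>2 e\<^sub>2 *\<^sub>R e\<^sub>2"
    using e I(2)[of e\<^sub>2 e\<^sub>1] by (simp_all add: L_def)
  ultimately show ?thesis using n e unfolding principal_curvatures_def by blast
qed

end

section \<open>Charts\<close>

text \<open>\<open>g\<close> extends \<open>\<psi>\<close>, which is only given on the half-plane side, to a full ball around \<open>x\<close>.\<close>

definition local_rep :: "(real^2) set \<Rightarrow> (real^2 \<Rightarrow> 'b::euclidean_space) \<Rightarrow> real^2 \<Rightarrow> real \<Rightarrow>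
    (real^2 \<Rightarrow> 'b) \<Rightarrow> (real^2 \<Rightarrow> (real^2) \<Rightarrow>\<^sub>L 'b) \<Rightarrow>
    (real^2 \<Rightarrow> (real^2) \<Rightarrow>\<^sub>L ((real^2) \<Rightarrow>\<^sub>L 'b)) \<Rightarrow> bool" where
  "local_rep T \<psi> x r g g' g'' \<longleftrightarrow> r > 0 \<and> C2_with (ball x r) g g' g'' \<and>
     ball x r \<inter> half_plane \<subseteq> T \<and> (\<forall>y\<in>ball x r \<inter> half_plane. \<psi> y = g y)"

lemma local_rep_exists:
  assumes "C2_on T \<psi>" "openin (top_of_set half_plane) T" "x \<in> T"
  obtains r g g' g'' where "local_rep T \<psi> x r g g' g''"
proof -
  obtain W g where W: "x \<in> W" "C2_open W g" "\<forall>y\<in>W \<inter> T. g y = \<psi> y"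
    using assms by (auto simp: C2_on_def)
  then obtain g' g'' where C2: "C2_with W g g' g''" by (auto simp: C2_open_def C2_with_def)
  obtain V where V: "open V" "T = half_plane \<inter> V" using assms(2) by (auto simp: openin_open)
  have "open (W \<inter> V)" "x \<in> W \<inter> V" using V W assms(3) C2_withD(1)[OF C2] by auto
  then obtain r where r: "r > 0" "ball x r \<subseteq> W \<inter> V" using open_contains_ball by meson
  have "local_rep T \<psi> x r g g' g''"
    unfolding local_rep_def using r V W(3) C2_with_subset[OF C2, of "ball x r"]
    by (simp add: subset_iff)
  then show thesis using that by blast
qed

lemma local_rep_has_derivative_within:
  assumes rep: "local_rep T \<psi> x r g g' g''" and T: "T \<subseteq> half_plane" and y: "y \<in> ball x r \<inter> half_plane"
  shows "(\<psi> has_derivative blinfun_apply (g' y)) (at y within T)"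
proof (rule has_derivative_transform_within)
  show "(g has_derivative blinfun_apply (g' y)) (at y within T)"
    using C2_withD(2)[of "ball x r" g g' g'' y] rep y has_derivative_at_withinI
    unfolding local_rep_def by blast
  show "y \<in> T" using rep y by (auto simp: local_rep_def)
  show "0 < r - dist y x" using y by (auto simp: dist_commute)
  show "g z = \<psi> z" if "z \<in> T" "dist z y < r - dist y x" for z
  proof -
    have "dist z x < r" using that dist_triangle[of z x y] by linarith
    then show ?thesis using rep that T by (auto simp: local_rep_def dist_commute)
  qed
qed

text \<open>Positive steps along the coordinate axes never leave the half-plane, and approach along
  a basis suffices for uniqueness. This identifies one-sided differentials at the boundary with
  derivatives of the extension.\<close>

lemma derivative_within_half_plane_unique:
  fixes y :: "real^2"
  assumes "openin (top_of_set half_plane) T" "y \<in> T"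
    and D: "(\<psi> has_derivative D) (at y within T)" "(\<psi> has_derivative D') (at y within T)"
  shows "D = D'"
proof (rule frechet_derivative_unique_within[OF D])
  fix i :: "real^2" and e :: real assume i: "i \<in> Basis" and e: "e > 0"
  obtain V where V: "open V" "T = half_plane \<inter> V" using assms(1) by (auto simp: openin_open)
  then obtain d where d: "d > 0" "ball y d \<subseteq> V" using assms(2) open_contains_ball by blast
  have i': "i $ 2 \<ge> 0" "norm i = 1" using i by (auto simp: Basis_vec_def axis_def norm_axis_1)
  let ?c = "min d e / 2"
  have "y + ?c *\<^sub>R i \<in> ball y d" using d e i' by (auto simp: dist_norm)
  moreover have "y + ?c *\<^sub>R i \<in> half_plane"
    using assms(2) V i' d e by (auto simp: half_plane_def)
  ultimately show "\<exists>c. 0 < \<bar>c\<bar> \<and> \<bar>c\<bar> < e \<and> y + c *\<^sub>R i \<in> T"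
    using d e V by (intro exI[of _ ?c]) auto
qed

lemma local_rep_interior:
  assumes rep: "local_rep T \<psi> x r g g' g''" and y: "y \<in> ball x r" "y $ 2 > 0"
  obtains V where "open V" "y \<in> V" "V \<subseteq> ball x r" "V \<subseteq> {u. u $ 2 > 0}" "C2_with V g g' g''"
    "\<And>z. z \<in> V \<Longrightarrow> \<psi> z = g z" "V \<subseteq> T"
proof -
  let ?V = "ball x r \<inter> {u. u $ 2 > 0}"
  have o: "open ?V" by (intro open_Int open_ball open_Collect_less continuous_intros)
  then have "C2_with ?V g g' g''" using rep C2_with_subset unfolding local_rep_def by blast
  then show thesis using o rep y by (intro that[of ?V]) (auto simp: local_rep_def half_plane_def)
qed

lemma linear_blinfun: "linear (blinfun_apply F)"
  by (simp add: blinfun.bounded_linear_right bounded_linear.linear)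

lemma bilinear_blinfun2: "bilinear (\<lambda>v w. blinfun_apply (blinfun_apply B v) w)"
  unfolding bilinear_def linear_iff
  by (simp add: blinfun.add_left blinfun.add_right blinfun.scaleR_left blinfun.scaleR_right)

section \<open>Charts, boundary points and the curvature of a cone-like surface\<close>

locale cone_like_surface =
  fixes X :: "'p topology" and \<A> :: "'p chart set" and f :: "'p \<Rightarrow> real^3"
  assumes cone: "cone_like_ends X \<A> f"
begin

abbreviation "int_S \<equiv> surface_interior X \<A>"

abbreviation "rep U \<phi> \<equiv> local_rep (\<phi> ` U) (in_chart f (U, \<phi>))"

lemma surface: "C2_surface_with_boundary X \<A>" and cpt: "compact_space X"
  and immersion: "C2_immersion \<A> f"
  using cone by (auto simp: cone_like_ends_def)

lemma chart:
  assumes "(U, \<phi>) \<in> \<A>"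
  shows "openin X U" "openin (top_of_set half_plane) (\<phi> ` U)"
    "homeomorphic_map (subtopology X U) (top_of_set (\<phi> ` U)) \<phi>" "U \<subseteq> topspace X"
    "inj_on \<phi> U" "\<phi> ` U \<subseteq> half_plane"
proof -
  show 1: "openin X U" "openin (top_of_set half_plane) (\<phi> ` U)"
    "homeomorphic_map (subtopology X U) (top_of_set (\<phi> ` U)) \<phi>"
    using surface assms unfolding C2_surface_with_boundary_def by auto
  show U: "U \<subseteq> topspace X" using 1(1) openin_subset by blast
  then show "inj_on \<phi> U"
    using homeomorphic_imp_injective_map[OF 1(3)] by (simp add: Int_absorb1)
  show "\<phi> ` U \<subseteq> half_plane" using openin_imp_subset[OF 1(2)] .
qed

lemma ex_chart:
  assumes "p \<in> topspace X"
  obtains U \<phi> where "(U, \<phi>) \<in> \<A>" "p \<in> U"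
proof -
  have "(\<Union>(U, \<phi>)\<in>\<A>. U) = topspace X" using surface by (simp add: C2_surface_with_boundary_def)
  then show thesis using assms that by blast
qed

lemma chart_image_open:
  assumes "(U, \<phi>) \<in> \<A>" "openin X V"
  shows "openin (top_of_set half_plane) (\<phi> ` (U \<inter> V))"
proof -
  have "openin (subtopology X U) (U \<inter> V)" using assms(2) by (auto simp: openin_subtopology)
  then have "openin (top_of_set (\<phi> ` U)) (\<phi> ` (U \<inter> V))"
    using chart(3)[OF assms(1)] homeomorphic_imp_open_map open_map_def by blast
  then show ?thesis using chart(2)[OF assms(1)] openin_trans by blast
qed

lemma chart_preimage_open:
  assumes "(U, \<phi>) \<in> \<A>" "open B"
  shows "openin X {p \<in> U. \<phi> p \<in> B}"
proof -
  have "continuous_map (subtopology X U) euclidean \<phi>"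
    using chart(3)[OF assms(1)] homeomorphic_imp_continuous_map continuous_map_into_fulltopology by blast
  then have "openin (subtopology X U) {p \<in> topspace (subtopology X U). \<phi> p \<in> B}"
    using openin_continuous_map_preimage assms(2) by (metis open_openin)
  then show ?thesis
    using chart(1,4)[OF assms(1)] openin_trans_full by (simp add: Int_absorb1)
qed

lemma in_chart_apply:
  assumes "(U, \<phi>) \<in> \<A>" "p \<in> U"
  shows "in_chart f (U, \<phi>) (\<phi> p) = f p" "inv_into U \<phi> (\<phi> p) = p"
  using assms chart(5)[OF assms(1)] by (simp_all add: in_chart_def)

lemma height_pos: "p \<in> int_S \<Longrightarrow> 0 < f p $ 3"
  and height_boundary: "p \<in> surface_boundary X \<A> \<Longrightarrow> f p $ 3 = 0"
proof -
  have "f ` int_S \<subseteq> half_space" "f ` surface_boundary X \<A> \<subseteq> {x. x $ 3 = 0}"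
    using cone by (simp_all add: cone_like_ends_def)
  then show "p \<in> int_S \<Longrightarrow> 0 < f p $ 3" "p \<in> surface_boundary X \<A> \<Longrightarrow> f p $ 3 = 0"
    by (auto simp: half_space_def)
qed

lemma height_nonneg: "p \<in> topspace X \<Longrightarrow> 0 \<le> f p $ 3"
  using height_pos height_boundary by (cases "p \<in> surface_boundary X \<A>") (auto simp: surface_interior_def less_imp_le)

lemma rep_exists:
  assumes "(U, \<phi>) \<in> \<A>" "p \<in> U"
  obtains r g g' g'' where "rep U \<phi> (\<phi> p) r g g' g''"
proof -
  have "C2_on (\<phi> ` U) (in_chart f (U, \<phi>))"
    using immersion assms(1) unfolding C2_immersion_def by auto
  then show thesis using local_rep_exists[OF _ chart(2)[OF assms(1)]] assms(2) that by blast
qed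

text \<open>The immersion condition carried over to the extension. It includes the boundary line,
  where it keeps the denominator of \<open>curvature_formula\<close> away from zero.\<close>

lemma rep_normal_nonzero:
  assumes "(U, \<phi>) \<in> \<A>" "rep U \<phi> x r g g' g''" "y \<in> ball x r \<inter> half_plane"
  shows "normal_vec (g' y) \<noteq> 0"
proof -
  have y: "y \<in> \<phi> ` U" using assms by (auto simp: local_rep_def)
  then obtain D where D: "(in_chart f (U, \<phi>) has_derivative D) (at y within \<phi> ` U)" "inj D"
    using immersion assms(1) unfolding C2_immersion_def by blast
  have "D = blinfun_apply (g' y)"
    using derivative_within_half_plane_unique[OF chart(2)[OF assms(1)] y D(1)]
      local_rep_has_derivative_within[OF assms(2) chart(6)[OF assms(1)] assms(3)] by blast
  then show ?thesis using D(2) normal_vec_nonzero[OF linear_blinfun] by blast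
qed

lemma rep_orthogonal:
  assumes "(U, \<phi>) \<in> \<A>" "rep U \<phi> x r g g' g''" "p \<in> U \<inter> surface_boundary X \<A>" "\<phi> p \<in> ball x r"
  shows "orthogonal_to_ideal_plane (g' (\<phi> p))"
proof -
  have "\<phi> p \<in> ball x r \<inter> half_plane" using assms chart(6)[OF assms(1)] by auto
  from local_rep_has_derivative_within[OF assms(2) chart(6)[OF assms(1)] this]
  show ?thesis using cone assms(1,3) unfolding cone_like_ends_def by blast
qed

lemma boundary_iff:
  assumes A: "(U, \<phi>) \<in> \<A>" and p: "p \<in> U"
  shows "p \<in> surface_boundary X \<A> \<longleftrightarrow> \<phi> p $ 2 = 0"
proof
  assume "\<phi> p $ 2 = 0"
  then show "p \<in> surface_boundary X \<A>"
    using assms chart(4)[OF A] unfolding surface_boundary_def by blast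
next
  \<comment> \<open>Otherwise the height would have an interior minimum at \<open>p\<close>, so the tangent plane would be
    horizontal, against orthogonality.\<close>
  assume b: "p \<in> surface_boundary X \<A>"
  show "\<phi> p $ 2 = 0"
  proof (rule ccontr)
    assume "\<phi> p $ 2 \<noteq> 0"
    then have pos: "\<phi> p $ 2 > 0" using chart(6)[OF A] p by (auto simp: half_plane_def)
    obtain r g g' g'' where rep: "rep U \<phi> (\<phi> p) r g g' g''" using rep_exists[OF assms] .
    then have "\<phi> p \<in> ball (\<phi> p) r" by (auto simp: local_rep_def)
    from local_rep_interior[OF rep this pos]
    obtain V where V: "open V" "\<phi> p \<in> V" "C2_with V g g' g''"
      "\<And>z. z \<in> V \<Longrightarrow> in_chart f (U, \<phi>) z = g z" "V \<subseteq> \<phi> ` U" by metis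
    have "((\<lambda>z. g z $ 3) has_derivative (\<lambda>v. g' (\<phi> p) v $ 3)) (at (\<phi> p))"
      by (rule bounded_linear.has_derivative[OF bounded_linear_vec_nth C2_withD(2)[OF V(3,2)]])
    moreover have "g (\<phi> p) $ 3 \<le> g z $ 3" if "z \<in> V" for z
    proof -
      obtain q where q: "q \<in> U" "z = \<phi> q" using V(5) \<open>z \<in> V\<close> by auto
      then have "g z = f q" using V(4)[OF that] in_chart_apply[OF A q(1)] by simp
      moreover have "g (\<phi> p) = f p" using V(4)[OF V(2)] in_chart_apply[OF A p] by simp
      ultimately show ?thesis
        using height_boundary[OF b] height_nonneg[of q] chart(4)[OF A] q by auto
    qed
    ultimately have "(\<lambda>v. g' (\<phi> p) v $ 3) = (\<lambda>v. 0)"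
      using differential_zero_maxmin[OF V(2,1)] by blast
    then have "axis 3 1 \<bullet> g' (\<phi> p) v = 0" for v
      by (simp add: inner_axis' fun_eq_iff)
    moreover have "orthogonal_to_ideal_plane (g' (\<phi> p))"
      using rep_orthogonal[OF A rep] p b \<open>\<phi> p \<in> ball (\<phi> p) r\<close> by blast
    ultimately have "axis 3 1 \<bullet> (axis 3 1 :: real^3) = 0"
      unfolding orthogonal_to_ideal_plane_def by blast
    then show False by simp
  qed
qed

lemma interior_iff:
  assumes A: "(U, \<phi>) \<in> \<A>" and p: "p \<in> U"
  shows "p \<in> int_S \<longleftrightarrow> \<phi> p $ 2 > 0"
proof -
  have "p \<in> topspace X" "\<phi> p \<in> half_plane" using chart(4,6)[OF A] p by blast+
  then show ?thesis using boundary_iff[OF assms] by (auto simp: surface_interior_def half_plane_def)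
qed

lemma rep_eq:
  assumes "(U, \<phi>) \<in> \<A>" "rep U \<phi> x r g g' g''" "p \<in> U" "\<phi> p \<in> ball x r"
  shows "g (\<phi> p) = f p"
proof -
  have "\<phi> p \<in> half_plane" using chart(6)[OF assms(1)] assms(3) by blast
  then have "in_chart f (U, \<phi>) (\<phi> p) = g (\<phi> p)" using assms(2,4) by (simp add: local_rep_def)
  then show ?thesis using in_chart_apply[OF assms(1,3)] by simp
qed

text \<open>Restricted to interior points because the geometric notions use two-sided derivatives of
  the chart expression, which is known to agree with \<open>g\<close> only on the half-plane
  side.\<close>

lemma rep_immersed_point:
  assumes A: "(U, \<phi>) \<in> \<A>" and rep: "rep U \<phi> x r g g' g''"
    and p: "p \<in> U" "\<phi> p \<in> ball x r" "p \<in> int_S"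
  shows "immersed_point (in_chart f (U, \<phi>)) (\<phi> p) (g' (\<phi> p)) (\<lambda>v w. g'' (\<phi> p) v w)"
proof -
  have pos: "\<phi> p $ 2 > 0" using interior_iff[OF A p(1)] p(3) by simp
  obtain V where V: "\<phi> p \<in> V" "C2_with V g g' g''" "\<And>z. z \<in> V \<Longrightarrow> in_chart f (U, \<phi>) z = g z"
    using local_rep_interior[OF rep p(2) pos] by metis
  show ?thesis
  proof (rule immersed_point.intro)
    show "normal_vec (g' (\<phi> p)) \<noteq> 0"
      using rep_normal_nonzero[OF A rep] p chart(6)[OF A] by blast
    show "0 < in_chart f (U, \<phi>) (\<phi> p) $ 3" using in_chart_apply[OF A p(1)] height_pos[OF p(3)] by simp
    show "linear (g' (\<phi> p))" by (rule linear_blinfun)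
    show "bilinear (\<lambda>v w. g'' (\<phi> p) v w)" by (rule bilinear_blinfun2)
    show "g'' (\<phi> p) v w = g'' (\<phi> p) w v" for v w by (rule C2_with_symmetric[OF V(2,1)])
    show "deriv1 (in_chart f (U, \<phi>)) (\<phi> p) v = g' (\<phi> p) v" for v
      by (simp add: frechet_derivative_C2_with[OF V(2,1,3)])
    show "deriv2 (in_chart f (U, \<phi>)) (\<phi> p) v w = g'' (\<phi> p) v w" for v w
      by (simp add: frechet_derivative2_C2_with[OF V(2,1,3)])
  qed
qed

text \<open>Near \<open>\<phi> p\<close> one chart expression is the other composed with the C2
  transition map, so the chain rule supplies exactly the data of a change of coordinates.\<close>

lemma curvature_formula_chart_independent:
  assumes A: "(U, \<phi>) \<in> \<A>" and rep: "rep U \<phi> x r g g' g''" and p: "p \<in> U" "\<phi> p \<in> ball x r"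
    and B: "(V, \<theta>) \<in> \<A>" and repB: "rep V \<theta> y s h h' h''" and pB: "p \<in> V" "\<theta> p \<in> ball y s"
    and int: "p \<in> int_S"
  shows "curvature_formula (f p $ 3) (g' (\<phi> p)) (\<lambda>v w. g'' (\<phi> p) v w)
    = curvature_formula (f p $ 3) (h' (\<theta> p)) (\<lambda>v w. h'' (\<theta> p) v w)"
proof -
  have pos: "\<phi> p $ 2 > 0" "\<theta> p $ 2 > 0"
    using interior_iff[OF A p(1)] interior_iff[OF B pB(1)] int by auto
  have "C2_on (\<phi> ` (U \<inter> V)) (\<theta> \<circ> inv_into U \<phi>)"
    using surface A B unfolding C2_surface_with_boundary_def by fast
  then obtain q \<tau> \<tau>' \<tau>'' where \<tau>: "local_rep (\<phi> ` (U \<inter> V)) (\<theta> \<circ> inv_into U \<phi>) (\<phi> p) q \<tau> \<tau>' \<tau>''"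
    using local_rep_exists[OF _ chart_image_open[OF A chart(1)[OF B]]] p pB by blast
  then have "\<phi> p \<in> ball (\<phi> p) q" by (simp add: local_rep_def)
  from local_rep_interior[OF \<tau> this pos(1)] obtain V1 where V1:
    "open V1" "\<phi> p \<in> V1" "C2_with V1 \<tau> \<tau>' \<tau>''" "\<And>z. z \<in> V1 \<Longrightarrow> (\<theta> \<circ> inv_into U \<phi>) z = \<tau> z"
    "V1 \<subseteq> \<phi> ` (U \<inter> V)" by metis
  from local_rep_interior[OF rep p(2) pos(1)] obtain V2 where V2:
    "open V2" "\<phi> p \<in> V2" "C2_with V2 g g' g''" "\<And>z. z \<in> V2 \<Longrightarrow> in_chart f (U, \<phi>) z = g z" by metis
  from local_rep_interior[OF repB pB(2) pos(2)] obtain V3 where V3: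
    "open V3" "\<theta> p \<in> V3" "C2_with V3 h h' h''" "\<And>z. z \<in> V3 \<Longrightarrow> in_chart f (V, \<theta>) z = h z" by metis
  \<comment> \<open>A common neighbourhood on which the transition map and the first chart
    expression are represented, and whose image lies where the second one is.\<close>
  define W where "W = V1 \<inter> V2 \<inter> \<tau> -` V3"
  have "open (V1 \<inter> \<tau> -` V3)"
    using continuous_open_preimage[OF C2_with_continuous(1)[OF V1(3)] V1(1) V3(1)] .
  then have "open (V2 \<inter> (V1 \<inter> \<tau> -` V3))" using V2(1) by blast
  then have W: "open W" by (simp add: W_def ac_simps)
  have \<tau>p: "\<tau> (\<phi> p) = \<theta> p" using V1(4)[OF V1(2)] in_chart_apply[OF A p(1)] by simp
  then have pW: "\<phi> p \<in> W" using V1 V2 V3 by (simp add: W_def)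
  have eq: "g z = h (\<tau> z)" if z: "z \<in> W" for z
  proof -
    obtain q where q: "q \<in> U" "q \<in> V" "z = \<phi> q" using V1(5) z by (auto simp: W_def)
    then have "\<tau> z = \<theta> q" using V1(4)[of z] z in_chart_apply[OF A q(1)] by (simp add: W_def)
    then have "h (\<tau> z) = f q"
      using V3(4)[of "\<tau> z"] z in_chart_apply[OF B q(2)] by (simp add: W_def)
    moreover have "g z = f q" using V2(4)[of z] z in_chart_apply[OF A q(1)] q by (simp add: W_def)
    ultimately show ?thesis by simp
  qed
  have C\<tau>: "C2_with W \<tau> \<tau>' \<tau>''" using C2_with_subset[OF V1(3) W] by (auto simp: W_def)
  have Cg: "C2_with W g g' g''" using C2_with_subset[OF V2(3) W] by (auto simp: W_def)
  have sub: "\<tau> ` W \<subseteq> V3" by (auto simp: W_def)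
  note chain = C2_with_compose[where h = g, OF V3(3) C\<tau> sub pW _ Cg, unfolded \<tau>p]
  have chain1: "g' (\<phi> p) v = h' (\<theta> p) (\<tau>' (\<phi> p) v)" for v
    using chain(1) eq by blast
  have chain2: "g'' (\<phi> p) v w = h'' (\<theta> p) (\<tau>' (\<phi> p) v) (\<tau>' (\<phi> p) w) + h' (\<theta> p) (\<tau>'' (\<phi> p) v w)" for v w
    using chain(2) eq by blast
  interpret imm: immersed_point "in_chart f (U, \<phi>)" "\<phi> p" "g' (\<phi> p)" "\<lambda>v w. g'' (\<phi> p) v w"
    by (rule rep_immersed_point[OF A rep p int])
  show ?thesis
    by (rule curvature_formula_change_of_coordinates[where R = "\<lambda>v w. \<tau>'' (\<phi> p) v w",
          OF linear_blinfun bilinear_blinfun2 linear_blinfun chain1 chain2 imm.nz])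
qed

text \<open>Every admissible product of principal curvatures, in whatever chart and eigenbasis, is
  the formula in that chart, and the formula does not depend on the chart; so the description is
  satisfied by one number only.\<close>

lemma extrinsic_curvature_eq:
  assumes A: "(U, \<phi>) \<in> \<A>" and rep: "rep U \<phi> x r g g' g''"
    and p: "p \<in> U" "\<phi> p \<in> ball x r" "p \<in> int_S"
  shows "extrinsic_curvature \<A> f p = curvature_formula (f p $ 3) (g' (\<phi> p)) (\<lambda>v w. g'' (\<phi> p) v w)"
    (is "_ = ?K")
  unfolding extrinsic_curvature_def
proof (rule the_equality)
  interpret imm: immersed_point "in_chart f (U, \<phi>)" "\<phi> p" "g' (\<phi> p)" "\<lambda>v w. g'' (\<phi> p) v w"
    by (rule rep_immersed_point[OF A rep p])
  obtain k\<^sub>1 k\<^sub>2 where k: "principal_curvatures (in_chart f (U, \<phi>)) (\<phi> p) k\<^sub>1 k\<^sub>2"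
    using imm.principal_curvatures_exist by blast
  moreover have "?K = k\<^sub>1 * k\<^sub>2"
    using imm.principal_curvatures_product[OF k] in_chart_apply[OF A p(1)] by simp
  ultimately show "\<exists>(U, \<phi>)\<in>\<A>. p \<in> U \<and> (\<exists>k\<^sub>1 k\<^sub>2. principal_curvatures (in_chart f (U, \<phi>)) (\<phi> p) k\<^sub>1 k\<^sub>2 \<and> ?K = k\<^sub>1 * k\<^sub>2)"
    using A p(1) by blast
next
  fix k
  assume "\<exists>(U, \<phi>)\<in>\<A>. p \<in> U \<and> (\<exists>k\<^sub>1 k\<^sub>2. principal_curvatures (in_chart f (U, \<phi>)) (\<phi> p) k\<^sub>1 k\<^sub>2 \<and> k = k\<^sub>1 * k\<^sub>2)"
  then obtain V \<theta> k\<^sub>1 k\<^sub>2 where B: "(V, \<theta>) \<in> \<A>" "p \<in> V"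
    and k: "principal_curvatures (in_chart f (V, \<theta>)) (\<theta> p) k\<^sub>1 k\<^sub>2" "k = k\<^sub>1 * k\<^sub>2" by blast
  obtain s h h' h'' where repB: "rep V \<theta> (\<theta> p) s h h' h''" using rep_exists[OF B] .
  then have s: "\<theta> p \<in> ball (\<theta> p) s" by (simp add: local_rep_def)
  interpret imm: immersed_point "in_chart f (V, \<theta>)" "\<theta> p" "h' (\<theta> p)" "\<lambda>v w. h'' (\<theta> p) v w"
    by (rule rep_immersed_point[OF B(1) repB B(2) s p(3)])
  have "k = curvature_formula (f p $ 3) (h' (\<theta> p)) (\<lambda>v w. h'' (\<theta> p) v w)"
    using imm.principal_curvatures_product[OF k(1)] in_chart_apply[OF B] k(2) by simp
  then show "k = ?K"
    using curvature_formula_chart_independent[OF A rep p(1,2) B(1) repB B(2) s p(3)] by simp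
qed

end

section \<open>Boundedness of the curvature form at the ideal boundary\<close>

lemma eventually_nhds_ballE:
  assumes "eventually P (nhds x)"
  obtains d where "d > 0" "\<And>y. y \<in> ball x d \<Longrightarrow> P y"
  using assms by (auto simp: eventually_nhds_metric dist_commute)

lemma eventually_nhds_bounded:
  fixes F :: "'a::t2_space \<Rightarrow> real"
  assumes "isCont F x"
  obtains B where "B > 0" "eventually (\<lambda>y. \<bar>F y\<bar> \<le> B) (nhds x)"
proof -
  have "eventually (\<lambda>y. dist (F y) (F x) < 1) (nhds x)"
    using assms[THEN isContD, THEN tendstoD, of 1] by (simp add: eventually_nhds_conv_at)
  then have "eventually (\<lambda>y. \<bar>F y\<bar> \<le> \<bar>F x\<bar> + 1) (nhds x)"
    by eventually_elim (simp add: dist_real_def)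
  then show thesis by (intro that[of "\<bar>F x\<bar> + 1"]) auto
qed

lemma eventually_nhds_bounded_below:
  fixes F :: "'a::t2_space \<Rightarrow> real"
  assumes "isCont F x" "F x > 0"
  obtains c where "c > 0" "eventually (\<lambda>y. c \<le> F y) (nhds x)"
proof -
  have "eventually (\<lambda>y. F x / 2 < F y) (at x)"
    using assms by (intro order_tendstoD(1)[OF isContD[OF assms(1)]]) auto
  then have "eventually (\<lambda>y. F x / 2 < F y) (nhds x)"
    using assms by (simp add: eventually_nhds_conv_at)
  then have "eventually (\<lambda>y. F x / 2 \<le> F y) (nhds x)" by eventually_elim simp
  then show thesis using assms by (intro that[of "F x / 2"]) auto
qed

text \<open>The mean value theorem on the vertical segment from the boundary line up to
  \<open>y\<close>. Applied to the normal's vertical component and to the height, it compares both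
  with \<open>y $ 2\<close>.\<close>

lemma vertical_mean_value:
  fixes k :: "real^2 \<Rightarrow> real"
  assumes k: "\<And>z. z \<in> ball x d \<Longrightarrow> (k has_derivative k' z) (at z)"
    and 0: "\<And>z. z \<in> ball x d \<Longrightarrow> z $ 2 = 0 \<Longrightarrow> k z = 0"
    and x: "x $ 2 = 0" and y: "y \<in> ball x d" "y $ 2 \<ge> 0"
  obtains z where "z \<in> ball x d" "k y = y $ 2 * k' z (axis 2 1)"
proof -
  define y0 where "y0 = y - y $ 2 *\<^sub>R axis 2 1"
  \<comment> \<open>As \<open>x\<close> lies on the boundary line, lowering \<open>y\<close> keeps
    its horizontal and reduces its vertical distance to \<open>x\<close>, so the segment stays in
    the ball.\<close>
  have in_ball: "y0 + t *\<^sub>R axis 2 1 \<in> ball x d" if t: "0 \<le> t" "t \<le> y $ 2" for t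
  proof -
    have c: "(x - (y0 + t *\<^sub>R axis 2 1)) $ 1 = (x - y) $ 1" "(x - (y0 + t *\<^sub>R axis 2 1)) $ 2 = - t"
      "(x - y) $ 2 = - (y $ 2)"
      using x by (simp_all add: y0_def axis_def)
    have "norm (x - (y0 + t *\<^sub>R axis 2 1)) \<le> norm (x - y)"
      unfolding norm_eq_sqrt_inner inner_vec_def sum_2 c using t by (simp add: mult_mono)
    then show ?thesis using y by (simp add: dist_norm)
  qed
  have "\<exists>t\<in>{0..y $ 2}. k (y0 + (y $ 2) *\<^sub>R axis 2 1) - k (y0 + 0 *\<^sub>R axis 2 1)
      = (\<lambda>h. k' (y0 + t *\<^sub>R axis 2 1) (h *\<^sub>R axis 2 1)) (y $ 2 - 0)"
  proof (rule mvt_very_simple[OF y(2)])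
    fix t assume t: "0 \<le> t" "t \<le> y $ 2"
    have "((\<lambda>t. y0 + t *\<^sub>R axis 2 1) has_derivative (\<lambda>h. h *\<^sub>R axis 2 1)) (at t within {0..y $ 2})"
      by (auto intro!: derivative_eq_intros)
    from has_derivative_compose[OF this k[OF in_ball[OF t]]]
    show "((\<lambda>t. k (y0 + t *\<^sub>R axis 2 1)) has_derivative
        (\<lambda>h. k' (y0 + t *\<^sub>R axis 2 1) (h *\<^sub>R axis 2 1))) (at t within {0..y $ 2})" .
  qed
  then obtain t where t: "0 \<le> t" "t \<le> y $ 2"
    and eq: "k y - k y0 = k' (y0 + t *\<^sub>R axis 2 1) ((y $ 2) *\<^sub>R axis 2 1)"
    by (auto simp: y0_def)
  have "k y0 = 0" using 0[of y0] in_ball[of 0] y(2) by (simp add: y0_def axis_def)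
  moreover have "linear (k' (y0 + t *\<^sub>R axis 2 1))"
    using k[OF in_ball[OF t]] has_derivative_linear by blast
  ultimately show thesis
    using eq in_ball[OF t] by (intro that) (auto simp: linear_scale)
qed

lemma C2_with_isCont:
  assumes "C2_with W g g' g''" "x \<in> W"
  shows "isCont g x" "isCont g' x" "isCont g'' x"
  using C2_with_continuous[OF assms(1)] C2_withD(4)[OF assms(1)] assms(2)
    continuous_on_eq_continuous_at[OF C2_withD(1)[OF assms(1)]] by auto

lemma isCont_normal_vec:
  assumes "C2_with W g g' g''" "x \<in> W"
  shows "isCont (\<lambda>y. normal_vec (g' y)) x"
  unfolding normal_vec_def
  by (intro continuous_cross blinfun.continuous continuous_const C2_with_isCont(2)[OF assms])

lemma isCont_vec_nth: "isCont F x \<Longrightarrow> isCont (\<lambda>y. F y $ i) x"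
  unfolding isCont_def by (rule tendsto_vec_nth)

lemma isCont_curvature_formula:
  assumes "C2_with W g g' g''" "x \<in> W" "g x $ 3 \<noteq> 0" "normal_vec (g' x) \<noteq> 0"
  shows "isCont (\<lambda>y. curvature_formula (g y $ 3) (g' y) (\<lambda>v w. g'' y v w)) x"
proof -
  have "isCont (\<lambda>y. scaled_second_form (g y $ 3) (g' y) (\<lambda>v w. g'' y v w) v w) x" for v w
    unfolding scaled_second_form_def using assms(3)
    by (intro continuous_intros isCont_vec_nth isCont_normal_vec[OF assms(1,2)]
        C2_with_isCont[OF assms(1,2)]) auto
  then show ?thesis
    unfolding curvature_formula_def form_det_def using assms(4)
    by (intro continuous_intros isCont_vec_nth isCont_normal_vec[OF assms(1,2)]
        C2_with_isCont[OF assms(1,2)]) auto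
qed

section \<open>Estimates up to the ideal boundary\<close>

context cone_like_surface
begin

lemma normal_height_bound:
  assumes A: "(U, \<phi>) \<in> \<A>" and p: "p \<in> U" and rep: "rep U \<phi> (\<phi> p) r g g' g''"
  obtains C where "C > 0"
    "eventually (\<lambda>y. y $ 2 > 0 \<longrightarrow> \<bar>normal_vec (g' y) $ 3\<bar> \<le> C * g y $ 3) (nhds (\<phi> p))"
proof -
  let ?x = "\<phi> p" and ?m = "\<lambda>y. normal_vec (g' y) $ 3"
  have r: "r > 0" and C2: "C2_with (ball ?x r) g g' g''" and x: "?x \<in> ball ?x r"
    using rep by (auto simp: local_rep_def)
  have U: "\<exists>q\<in>U. y = \<phi> q" if "y \<in> ball ?x r" "y $ 2 \<ge> 0" for y
    using rep that by (auto simp: local_rep_def half_plane_def)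
  show thesis
  proof (cases "?x $ 2 = 0")
    \<comment> \<open>Off the boundary line the height is bounded below near \<open>?x\<close>, and
      continuity of the normal suffices.\<close>
    case False
    then have "p \<in> int_S" using boundary_iff[OF A p] chart(4)[OF A] p by (auto simp: surface_interior_def)
    then have pos: "g ?x $ 3 > 0" using height_pos rep_eq[OF A rep p x] by simp
    obtain B where B: "B > 0" "eventually (\<lambda>y. \<bar>?m y\<bar> \<le> B) (nhds ?x)"
      using eventually_nhds_bounded[OF isCont_vec_nth[OF isCont_normal_vec[OF C2 x]]] .
    obtain c where c: "c > 0" "eventually (\<lambda>y. c \<le> g y $ 3) (nhds ?x)"
      using eventually_nhds_bounded_below[OF isCont_vec_nth[OF C2_with_isCont(1)[OF C2 x]] pos] .
    from B(2) c(2) have "eventually (\<lambda>y. y $ 2 > 0 \<longrightarrow> \<bar>?m y\<bar> \<le> (B / c) * g y $ 3) (nhds ?x)"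
    proof eventually_elim
      case (elim y)
      have "\<bar>?m y\<bar> \<le> (B / c) * c" using elim c by simp
      also have "\<dots> \<le> (B / c) * g y $ 3" using elim B c by (intro mult_left_mono) auto
      finally show ?case by simp
    qed
    then show thesis using B c by (intro that[of "B / c"]) auto
  next
    case x2: True
    \<comment> \<open>Both the vertical component of the normal and the height vanish on the boundary line; the
      former is \<open>C\<^sup>1\<close> and the latter has nonzero derivative across it, so both are compared with \<open>y $ 2\<close>.\<close>
    have zero: "g y $ 3 = 0" "?m y = 0" if y: "y \<in> ball ?x r" "y $ 2 = 0" for y
    proof -
      obtain q where q: "q \<in> U" "y = \<phi> q" using U[OF y(1)] y(2) by auto
      then have b: "q \<in> surface_boundary X \<A>" using boundary_iff[OF A q(1)] y by simp
      show "g y $ 3 = 0" using rep_eq[OF A rep q(1)] q y height_boundary[OF b] by simp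
      have "orthogonal_to_ideal_plane (g' y)" using rep_orthogonal[OF A rep] q b y by blast
      then have "normal_vec (g' y) \<bullet> axis 3 1 = 0"
        using normal_vec_orthogonal[OF linear_blinfun] unfolding orthogonal_to_ideal_plane_def by blast
      then show "?m y = 0" by (simp add: inner_axis)
    qed
    have D: "((\<lambda>z. g' z v $ i) has_derivative (\<lambda>w. g'' y w v $ i)) (at y)" if "y \<in> ball ?x r" for v i y
      by (rule bounded_linear.has_derivative[OF bounded_linear_vec_nth
            C2_with_has_derivative_apply[OF C2 that]])
    have Dg: "((\<lambda>z. g z $ 3) has_derivative (\<lambda>w. g' y w $ 3)) (at y)" if "y \<in> ball ?x r" for y
      by (rule bounded_linear.has_derivative[OF bounded_linear_vec_nth C2_withD(2)[OF C2 that]])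
    have m: "?m y = g' y (axis 1 1) $ 1 * g' y (axis 2 1) $ 2 - g' y (axis 1 1) $ 2 * g' y (axis 2 1) $ 1" for y
      by (simp add: normal_vec_def cross_components)
    \<comment> \<open>The product rule for the third component of the cross product. It involves
      \<open>g''\<close> but no higher derivative, so C2 makes it continuous.\<close>
    define m' where "m' = (\<lambda>y w. (g' y (axis 1 1) $ 1 * g'' y w (axis 2 1) $ 2
        + g'' y w (axis 1 1) $ 1 * g' y (axis 2 1) $ 2)
        - (g' y (axis 1 1) $ 2 * g'' y w (axis 2 1) $ 1
        + g'' y w (axis 1 1) $ 2 * g' y (axis 2 1) $ 1))"
    have Dm: "(?m has_derivative m' y) (at y)" if "y \<in> ball ?x r" for y
      unfolding m m'_def by (intro has_derivative_diff has_derivative_mult D[OF that])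
    have "isCont (\<lambda>y. m' y (axis 2 1)) ?x"
      unfolding m'_def by (intro continuous_intros isCont_vec_nth C2_with_isCont[OF C2 x])
    then obtain B where B: "B > 0" "eventually (\<lambda>y. \<bar>m' y (axis 2 1)\<bar> \<le> B) (nhds ?x)"
      using eventually_nhds_bounded by blast
    \<comment> \<open>The line through \<open>?x\<close> along the first axis lies in the
      half-plane, where \<open>g\<close> is the true chart expression and the height is zero on both
      sides of \<open>?x\<close>.\<close>
    have g'1: "g' ?x (axis 1 1) $ 3 = 0"
    proof -
      have "((\<lambda>t::real. ?x + t *\<^sub>R axis 1 1) has_derivative (\<lambda>h. h *\<^sub>R axis 1 1)) (at 0)"
        by (auto intro!: derivative_eq_intros)
      from has_derivative_compose[OF this, of "\<lambda>z. g z $ 3" "\<lambda>w. g' ?x w $ 3"] Dg[OF x]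
      have "((\<lambda>t. g (?x + t *\<^sub>R axis 1 1) $ 3) has_derivative (\<lambda>h. g' ?x (h *\<^sub>R axis 1 1) $ 3)) (at 0)"
        by simp
      moreover have "((\<lambda>t. g (?x + t *\<^sub>R axis 1 1) $ 3) has_derivative (\<lambda>h. 0)) (at 0)"
      proof (rule has_derivative_transform_within_open[of "\<lambda>t. 0" _ _ _ "ball 0 r"])
        show "0 = g (?x + t *\<^sub>R axis 1 1) $ 3" if "t \<in> ball 0 r" for t
        proof -
          have "(?x + t *\<^sub>R axis 1 1) $ 2 = 0" using x2 by (simp add: axis_def)
          then show ?thesis using zero(1)[of "?x + t *\<^sub>R axis 1 1"] that by (simp add: dist_norm)
        qed
      qed (use r in auto)
      ultimately have "(\<lambda>h. g' ?x (h *\<^sub>R axis 1 1) $ 3) = (\<lambda>h. 0)"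
        by (rule has_derivative_unique)
      from fun_cong[OF this, of 1] show ?thesis by simp
    qed
    have "g' ?x (axis 2 1) $ 3 \<noteq> 0"
    proof
      assume "g' ?x (axis 2 1) $ 3 = 0"
      then have "axis 3 1 \<bullet> g' ?x v = 0" for v
        unfolding linear_expand2[OF linear_blinfun, of "g' ?x" v] using g'1
        by (simp add: inner_axis')
      moreover have "orthogonal_to_ideal_plane (g' ?x)"
        using rep_orthogonal[OF A rep] p x boundary_iff[OF A p] x2 by blast
      ultimately have "axis 3 1 \<bullet> (axis 3 1 :: real^3) = 0"
        unfolding orthogonal_to_ideal_plane_def by blast
      then show False by simp
    qed
    then have "\<bar>g' ?x (axis 2 1) $ 3\<bar> > 0" by simp
    moreover have "isCont (\<lambda>y. \<bar>g' y (axis 2 1) $ 3\<bar>) ?x"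
      by (intro continuous_intros isCont_vec_nth C2_with_isCont[OF C2 x])
    ultimately obtain c where c: "c > 0" "eventually (\<lambda>y. c \<le> \<bar>g' y (axis 2 1) $ 3\<bar>) (nhds ?x)"
      using eventually_nhds_bounded_below by blast
    have "eventually (\<lambda>y. \<bar>m' y (axis 2 1)\<bar> \<le> B \<and> c \<le> \<bar>g' y (axis 2 1) $ 3\<bar> \<and> y \<in> ball ?x r) (nhds ?x)"
      using B(2) c(2) r by (intro eventually_conj eventually_nhds_in_open) auto
    then obtain d where d: "d > 0" and bd: "\<And>y. y \<in> ball ?x d \<Longrightarrow>
        \<bar>m' y (axis 2 1)\<bar> \<le> B \<and> c \<le> \<bar>g' y (axis 2 1) $ 3\<bar> \<and> y \<in> ball ?x r"
      by (rule eventually_nhds_ballE) blast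
    \<comment> \<open>The two mean values are attained at different points \<open>z\<close> and
      \<open>z'\<close>; this is harmless because \<open>B\<close> and \<open>c\<close> are uniform
      on the ball. Their quotient is the constant sought.\<close>
    have "\<bar>?m y\<bar> \<le> (B / c) * g y $ 3" if y: "y \<in> ball ?x d" "y $ 2 > 0" for y
    proof -
      have br: "z \<in> ball ?x r" if "z \<in> ball ?x d" for z using bd[OF that] by blast
      obtain z where z: "z \<in> ball ?x d" "?m y = y $ 2 * m' z (axis 2 1)"
        using vertical_mean_value[OF Dm[OF br] zero(2)[OF br] x2 y(1) less_imp_le[OF y(2)]] by blast
      obtain z' where z': "z' \<in> ball ?x d" "g y $ 3 = y $ 2 * g' z' (axis 2 1) $ 3"
        using vertical_mean_value[OF Dg[OF br] zero(1)[OF br] x2 y(1) less_imp_le[OF y(2)]] by blast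
      obtain q where q: "q \<in> U" "y = \<phi> q" using U bd[OF y(1)] y(2) by force
      then have "g y $ 3 \<ge> 0"
        using rep_eq[OF A rep q(1)] bd[OF y(1)] height_nonneg[of q] chart(4)[OF A] by auto
      \<comment> \<open>The transversal derivative is only known to be nonzero; nonnegativity of the
        height settles its sign.\<close>
      then have "g y $ 3 = y $ 2 * \<bar>g' z' (axis 2 1) $ 3\<bar>"
        using z'(2) y(2) by (metis abs_mult abs_of_nonneg less_imp_le)
      then have "y $ 2 * c \<le> g y $ 3" using bd[OF z'(1)] y(2) by (simp add: mult_left_mono)
      then have "y $ 2 \<le> g y $ 3 / c" using c by (simp add: field_simps)
      have "\<bar>?m y\<bar> = y $ 2 * \<bar>m' z (axis 2 1)\<bar>" using z(2) y(2) by (simp add: abs_mult)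
      also have "\<dots> \<le> (g y $ 3 / c) * B"
        using \<open>y $ 2 \<le> g y $ 3 / c\<close> bd[OF z(1)] y(2) by (intro mult_mono) auto
      finally show ?thesis by (simp add: mult.commute)
    qed
    then have "eventually (\<lambda>y. y $ 2 > 0 \<longrightarrow> \<bar>?m y\<bar> \<le> (B / c) * g y $ 3) (nhds ?x)"
      unfolding eventually_nhds_metric using d by (metis dist_commute mem_ball)
    then show thesis using B c by (intro that[of "B / c"]) auto
  qed
qed

text \<open>The squared height is kept in the bound because it will cancel the denominator of the
  area density, whose numerator is the second quantity bounded here.\<close>

lemma curvature_local_bound:
  assumes A: "(U, \<phi>) \<in> \<A>" and p: "p \<in> U" and rep: "rep U \<phi> (\<phi> p) r g g' g''"
  obtains C where "C > 0"
    "eventually (\<lambda>y. y $ 2 > 0 \<longrightarrow>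
       \<bar>curvature_formula (g y $ 3) (g' y) (\<lambda>v w. g'' y v w)\<bar> \<le> C * (g y $ 3)\<^sup>2
       \<and> norm (normal_vec (g' y)) \<le> C) (nhds (\<phi> p))"
proof -
  let ?x = "\<phi> p" and ?q = "\<lambda>y. scaled_second_form (g y $ 3) (g' y) (\<lambda>v w. g'' y v w)"
  have C2: "C2_with (ball ?x r) g g' g''" and x: "?x \<in> ball ?x r"
    using rep by (auto simp: local_rep_def)
  obtain C where C: "C > 0"
    "eventually (\<lambda>y. y $ 2 > 0 \<longrightarrow> \<bar>normal_vec (g' y) $ 3\<bar> \<le> C * g y $ 3) (nhds ?x)"
    using normal_height_bound[OF assms] .
  have bound: "\<exists>E>0. eventually (\<lambda>y. y $ 2 > 0 \<longrightarrow> \<bar>?q y v w\<bar> \<le> E) (nhds ?x)" for v w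
  proof -
    have c: "isCont (\<lambda>y. g'' y v w \<bullet> normal_vec (g' y)) ?x" "isCont (\<lambda>y. g' y v \<bullet> g' y w) ?x"
      by (intro continuous_intros isCont_normal_vec[OF C2 x] C2_with_isCont[OF C2 x])+
    obtain B1 where B1: "B1 > 0" "eventually (\<lambda>y. \<bar>g'' y v w \<bullet> normal_vec (g' y)\<bar> \<le> B1) (nhds ?x)"
      using eventually_nhds_bounded[OF c(1)] .
    obtain B2 where B2: "B2 > 0" "eventually (\<lambda>y. \<bar>g' y v \<bullet> g' y w\<bar> \<le> B2) (nhds ?x)"
      using eventually_nhds_bounded[OF c(2)] .
    from C(2) B1(2) B2(2) have "eventually (\<lambda>y. y $ 2 > 0 \<longrightarrow> \<bar>?q y v w\<bar> \<le> B1 + B2 * C) (nhds ?x)"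
    proof eventually_elim
      case (elim y)
      show ?case
      proof
        assume "y $ 2 > 0"
        then have *: "\<bar>normal_vec (g' y) $ 3\<bar> \<le> C * g y $ 3" using elim by simp
        then have "g y $ 3 \<ge> 0"
          using C(1) by (metis abs_ge_zero order_trans zero_le_mult_iff less_le_not_le)
        \<comment> \<open>If the height is zero the quotient is 0 by the convention for division, so
          nonnegativity is enough.\<close>
        then have "\<bar>normal_vec (g' y) $ 3 / g y $ 3\<bar> \<le> C"
          using * C(1) by (cases "g y $ 3 = 0") (auto simp: abs_divide divide_le_eq)
        then have "\<bar>(g' y v \<bullet> g' y w) * (normal_vec (g' y) $ 3 / g y $ 3)\<bar> \<le> B2 * C"
          unfolding abs_mult using elim B2(1) by (intro mult_mono) auto
        then show "\<bar>?q y v w\<bar> \<le> B1 + B2 * C"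
          unfolding scaled_second_form_def using elim by linarith
      qed
    qed
    then show ?thesis using B1(1) B2(1) C(1) by (intro exI[of _ "B1 + B2 * C"]) (simp add: add_pos_pos)
  qed
  define E where "E v w = (SOME e. e > 0 \<and> eventually (\<lambda>y. y $ 2 > 0 \<longrightarrow> \<bar>?q y v w\<bar> \<le> e) (nhds ?x))" for v w
  have E: "E v w > 0" "eventually (\<lambda>y. y $ 2 > 0 \<longrightarrow> \<bar>?q y v w\<bar> \<le> E v w) (nhds ?x)" for v w
    using someI_ex[OF bound[of v w]] unfolding E_def by auto
  have "?x \<in> half_plane" using chart(6)[OF A] p by blast
  then have "normal_vec (g' ?x) \<bullet> normal_vec (g' ?x) > 0"
    using rep_normal_nonzero[OF A rep] x by simp
  moreover have "isCont (\<lambda>y. normal_vec (g' y) \<bullet> normal_vec (g' y)) ?x"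
    by (intro continuous_intros isCont_normal_vec[OF C2 x])
  ultimately obtain c where c: "c > 0" "eventually (\<lambda>y. c \<le> normal_vec (g' y) \<bullet> normal_vec (g' y)) (nhds ?x)"
    using eventually_nhds_bounded_below by blast
  obtain B where B: "B > 0" "eventually (\<lambda>y. \<bar>norm (normal_vec (g' y))\<bar> \<le> B) (nhds ?x)"
    using eventually_nhds_bounded[OF continuous_norm[OF isCont_normal_vec[OF C2 x]]] .
  let ?a = "axis 1 1 :: real^2" and ?b = "axis 2 1 :: real^2"
  \<comment> \<open>The triangle inequality for the two-by-two determinant, over the square of the
    lower bound \<open>c\<close> for the squared length of the normal.\<close>
  define F where "F = (E ?a ?a * E ?b ?b + E ?a ?b * E ?b ?a) / c\<^sup>2"
  have "F > 0" using E(1) c by (simp add: F_def add_pos_pos)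
  have "eventually (\<lambda>y. y $ 2 > 0 \<longrightarrow>
       \<bar>curvature_formula (g y $ 3) (g' y) (\<lambda>v w. g'' y v w)\<bar> \<le> (F + B) * (g y $ 3)\<^sup>2
       \<and> norm (normal_vec (g' y)) \<le> F + B) (nhds ?x)"
    using E(2)[of ?a ?a] E(2)[of ?b ?b] E(2)[of ?a ?b] E(2)[of ?b ?a] c(2) B(2)
  proof eventually_elim
    case (elim y)
    let ?N = "normal_vec (g' y) \<bullet> normal_vec (g' y)"
    show ?case
    proof
      assume y: "y $ 2 > 0"
      have "\<bar>form_det (?q y) ?a ?b\<bar> \<le> \<bar>?q y ?a ?a\<bar> * \<bar>?q y ?b ?b\<bar> + \<bar>?q y ?a ?b\<bar> * \<bar>?q y ?b ?a\<bar>"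
        unfolding form_det_def abs_mult[symmetric] by linarith
      also have "\<dots> \<le> E ?a ?a * E ?b ?b + E ?a ?b * E ?b ?a"
        using elim y E(1) by (intro add_mono mult_mono) (auto simp: less_imp_le)
      finally have "\<bar>form_det (?q y) ?a ?b\<bar> / ?N\<^sup>2 \<le> F"
        unfolding F_def using elim c E(1)
        by (intro frac_le power_mono) (auto simp: less_imp_le intro!: add_nonneg_nonneg mult_nonneg_nonneg)
      then have "\<bar>curvature_formula (g y $ 3) (g' y) (\<lambda>v w. g'' y v w)\<bar> \<le> (g y $ 3)\<^sup>2 * F"
        unfolding curvature_formula_def
        by (simp add: abs_mult abs_divide mult_left_mono flip: times_divide_eq_right)
      also have "\<dots> \<le> (F + B) * (g y $ 3)\<^sup>2" using B by (simp add: algebra_simps)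
      finally show "\<bar>curvature_formula (g y $ 3) (g' y) (\<lambda>v w. g'' y v w)\<bar> \<le> (F + B) * (g y $ 3)\<^sup>2
         \<and> norm (normal_vec (g' y)) \<le> F + B"
        using elim \<open>F > 0\<close> by simp
    qed
  qed
  then show thesis using B \<open>F > 0\<close> by (intro that[of "F + B"]) auto
qed

end

section \<open>Integration over the surface\<close>

text \<open>The hypothesis \<open>em\<close> identifies the push-forward of \<open>M\<close>
  restricted to \<open>B\<close> with a density measure, and integrals follow. Measurability of
  \<open>d\<close> is asked only after cutting off by \<open>Q\<close>, since outside a chart image
  the density need not be controlled.\<close>

lemma nn_integral_chart:
  fixes M :: "'p measure" and \<phi> :: "'p \<Rightarrow> 'a::euclidean_space" and d :: "'a \<Rightarrow> ennreal"
  assumes B: "B \<in> sets M" and \<phi>: "\<phi> \<in> measurable (restrict_space M B) borel"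
    and d: "(\<lambda>u. d u * indicator Q u) \<in> borel_measurable borel"
    and em: "\<And>A. A \<in> sets borel \<Longrightarrow>
      emeasure M (\<phi> -` A \<inter> B) = (\<integral>\<^sup>+u. d u * indicator (A \<inter> Q) u \<partial>lborel)"
    and F: "F \<in> borel_measurable borel"
  shows "(\<integral>\<^sup>+p. F (\<phi> p) * indicator B p \<partial>M) = (\<integral>\<^sup>+u. d u * indicator Q u * F u \<partial>lborel)"
proof -
  let ?N = "restrict_space M B"
  have sp: "space ?N = B" using sets.sets_into_space[OF B] by (auto simp: space_restrict_space)
  have *: "distr ?N borel \<phi> = density lborel (\<lambda>u. d u * indicator Q u)"
  proof (rule measure_eqI)
    fix A assume "A \<in> sets (distr ?N borel \<phi>)"
    then have A: "A \<in> sets borel" by simp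
    have "emeasure (distr ?N borel \<phi>) A = emeasure ?N (\<phi> -` A \<inter> B)"
      using \<phi> A by (simp add: emeasure_distr sp)
    also have "\<dots> = emeasure M (\<phi> -` A \<inter> B)"
      using B by (intro emeasure_restrict_space) (auto dest: sets.sets_into_space)
    also have "\<dots> = (\<integral>\<^sup>+u. d u * indicator Q u * indicator A u \<partial>lborel)"
      unfolding em[OF A] by (intro nn_integral_cong) (auto simp: indicator_def)
    also have "\<dots> = emeasure (density lborel (\<lambda>u. d u * indicator Q u)) A"
      using d A by (simp add: emeasure_density)
    finally show "emeasure (distr ?N borel \<phi>) A = emeasure (density lborel (\<lambda>u. d u * indicator Q u)) A" .
  qed simp
  have "(\<integral>\<^sup>+p. F (\<phi> p) * indicator B p \<partial>M) = (\<integral>\<^sup>+p. F (\<phi> p) \<partial>?N)"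
    using B by (subst nn_integral_restrict_space) (auto dest: sets.sets_into_space)
  also have "\<dots> = (\<integral>\<^sup>+u. F u \<partial>distr ?N borel \<phi>)"
    using \<phi> F by (simp add: nn_integral_distr)
  also have "\<dots> = (\<integral>\<^sup>+u. d u * indicator Q u * F u \<partial>lborel)"
    unfolding * using d F by (simp add: nn_integral_density)
  finally show ?thesis .
qed

lemma borel_measurable_continuous_on_open_indicator:
  fixes h :: "'a::topological_space \<Rightarrow> real"
  assumes "open S" "continuous_on S h"
  shows "(\<lambda>u. ennreal (h u) * indicator S u) \<in> borel_measurable borel"
proof -
  have "(\<lambda>u. indicator S u *\<^sub>R h u) \<in> borel_measurable borel"
    using assms by (intro borel_measurable_continuous_on_indicator) auto
  then have "(\<lambda>u. ennreal (indicator S u *\<^sub>R h u)) \<in> borel_measurable borel" by measurable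
  moreover have "ennreal (indicator S u *\<^sub>R h u) = ennreal (h u) * indicator S u" for u
    by (auto simp: indicator_def)
  ultimately show ?thesis by simp
qed

section \<open>The curvature integral\<close>

locale cone_like_surface_area = cone_like_surface X \<A> f
  for X :: "'p topology" and \<A> f +
  fixes dS :: "'p measure"
  assumes area: "hyp_area_measure X \<A> f dS"
begin

abbreviation "K \<equiv> extrinsic_curvature \<A> f"

lemma space_dS: "space dS = int_S"
  and sets_dS: "sets dS = sigma_sets int_S {W. openin (subtopology X int_S) W}"
  using area by (auto simp: hyp_area_measure_def)

lemma emeasure_dS:
  assumes "(U, \<phi>) \<in> \<A>" "B \<in> sets dS" "B \<subseteq> U"
  shows "emeasure dS B = (\<integral>\<^sup>+u. ennreal (area_density (in_chart f (U, \<phi>)) u) * indicator (\<phi> ` B) u \<partial>lborel)"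
  using area assms unfolding hyp_area_measure_def by auto

lemma open_in_sets_dS: "openin (subtopology X int_S) W \<Longrightarrow> W \<in> sets dS"
  unfolding sets_dS by (rule sigma_sets.Basic) simp

lemma openin_Int_sets_dS: "openin X W \<Longrightarrow> W \<inter> int_S \<in> sets dS"
  by (rule open_in_sets_dS) (auto simp: openin_subtopology)

text \<open>\<open>K\<close> is in fact continuous on the interior: near each point it is the
  continuous curvature formula read in a single chart.\<close>

lemma K_measurable: "K \<in> borel_measurable dS"
proof (rule borel_measurableI)
  fix S :: "real set" assume S: "open S"
  have "openin (subtopology X int_S) (K -` S \<inter> int_S)"
  proof (subst openin_subopen, intro ballI)
    fix p assume p: "p \<in> K -` S \<inter> int_S"
    then have "p \<in> topspace X" by (auto simp: surface_interior_def)
    then obtain U \<phi> where A: "(U, \<phi>) \<in> \<A>" "p \<in> U" by (rule ex_chart)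
    obtain r g g' g'' where rep: "rep U \<phi> (\<phi> p) r g g' g''" using rep_exists[OF A] .
    then have r: "r > 0" "C2_with (ball (\<phi> p) r) g g' g''" "\<phi> p \<in> ball (\<phi> p) r"
      by (auto simp: local_rep_def)
    let ?k = "\<lambda>y. curvature_formula (g y $ 3) (g' y) (\<lambda>v w. g'' y v w)"
    have K: "K q = ?k (\<phi> q)" if "q \<in> U" "\<phi> q \<in> ball (\<phi> p) r" "q \<in> int_S" for q
      using extrinsic_curvature_eq[OF A(1) rep that] rep_eq[OF A(1) rep that(1,2)] by simp
    have "g (\<phi> p) $ 3 \<noteq> 0" using rep_eq[OF A(1) rep A(2) r(3)] height_pos[of p] p by simp
    moreover have "normal_vec (g' (\<phi> p)) \<noteq> 0"
      using rep_normal_nonzero[OF A(1) rep] r(3) chart(6)[OF A(1)] A(2) by blast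
    ultimately have "isCont ?k (\<phi> p)" using isCont_curvature_formula[OF r(2,3)] by blast
    moreover have "?k (\<phi> p) \<in> S" using p K[OF A(2) r(3)] by simp
    ultimately have "eventually (\<lambda>y. ?k y \<in> S) (nhds (\<phi> p))"
      using S topological_tendstoD[OF isContD] by (simp add: eventually_nhds_conv_at)
    then obtain V where V: "open V" "\<phi> p \<in> V" "\<And>y. y \<in> V \<Longrightarrow> ?k y \<in> S"
      by (auto simp: eventually_nhds)
    let ?W = "{q \<in> U. \<phi> q \<in> V \<inter> ball (\<phi> p) r}"
    have "openin X ?W" using V by (intro chart_preimage_open[OF A(1)]) auto
    then have "openin (subtopology X int_S) (?W \<inter> int_S)" by (auto simp: openin_subtopology)
    moreover have "p \<in> ?W \<inter> int_S" using A V r p by auto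
    moreover have "?W \<inter> int_S \<subseteq> K -` S \<inter> int_S" using K V(3) by auto
    ultimately show "\<exists>T. openin (subtopology X int_S) T \<and> p \<in> T \<and> T \<subseteq> K -` S \<inter> int_S" by blast
  qed
  then show "K -` S \<inter> space dS \<in> sets dS" unfolding space_dS by (rule open_in_sets_dS)
qed

text \<open>In a small chart ball the curvature is at most \<open>C\<close> times the squared height
  and the area density at most \<open>C\<close> over it, so the integral is at most
  \<open>C * C\<close> times the area of a Euclidean disc. The point \<open>p\<close> may lie on the
  boundary.\<close>

lemma locally_finite_curvature:
  assumes "p \<in> topspace X"
  obtains W where "openin X W" "p \<in> W"
    "(\<integral>\<^sup>+q. ennreal \<bar>K q\<bar> * indicator (W \<inter> int_S) q \<partial>dS) < \<infinity>"
proof -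
  obtain U \<phi> where A: "(U, \<phi>) \<in> \<A>" "p \<in> U" using ex_chart[OF assms] .
  obtain r g g' g'' where rep: "rep U \<phi> (\<phi> p) r g g' g''" using rep_exists[OF A] .
  then have r: "r > 0" "C2_with (ball (\<phi> p) r) g g' g''" "\<phi> p \<in> ball (\<phi> p) r"
    by (auto simp: local_rep_def)
  let ?k = "\<lambda>y. curvature_formula (g y $ 3) (g' y) (\<lambda>v w. g'' y v w)"
    and ?n = "\<lambda>y. norm (normal_vec (g' y))" and ?\<psi> = "in_chart f (U, \<phi>)"
  obtain C where C: "C > 0" "eventually (\<lambda>y. y $ 2 > 0 \<longrightarrow> \<bar>?k y\<bar> \<le> C * (g y $ 3)\<^sup>2 \<and> ?n y \<le> C) (nhds (\<phi> p))"
    using curvature_local_bound[OF A rep] .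
  have "eventually (\<lambda>y. (y $ 2 > 0 \<longrightarrow> \<bar>?k y\<bar> \<le> C * (g y $ 3)\<^sup>2 \<and> ?n y \<le> C) \<and> y \<in> ball (\<phi> p) r) (nhds (\<phi> p))"
    using C(2) r by (intro eventually_conj eventually_nhds_in_open) auto
  then obtain s where s: "s > 0" and sb: "\<And>y. y \<in> ball (\<phi> p) s \<Longrightarrow>
      (y $ 2 > 0 \<longrightarrow> \<bar>?k y\<bar> \<le> C * (g y $ 3)\<^sup>2 \<and> ?n y \<le> C) \<and> y \<in> ball (\<phi> p) r"
    by (rule eventually_nhds_ballE) blast
  define W where "W = {q \<in> U. \<phi> q \<in> ball (\<phi> p) s}"
  define B where "B = W \<inter> int_S"
  \<comment> \<open>\<open>Q\<close> is exactly the image of \<open>B\<close> under the chart: the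
    part of the ball strictly above the boundary line.\<close>
  define Q where "Q = ball (\<phi> p) s \<inter> {u. u $ 2 > 0}"
  have W: "openin X W" "p \<in> W"
    unfolding W_def using chart_preimage_open[OF A(1) open_ball] A(2) s by auto
  have openO: "open Q" unfolding Q_def by (intro open_Int open_ball open_Collect_less continuous_intros)
  have B: "B \<in> sets dS" unfolding B_def by (rule openin_Int_sets_dS[OF W(1)])
  have BU: "B \<subseteq> U" "B \<subseteq> int_S" by (auto simp: B_def W_def)
  have imO: "\<phi> q \<in> Q" if "q \<in> B" for q
    using that interior_iff[OF A(1), of q] by (auto simp: B_def W_def Q_def)
  have preO: "\<exists>q\<in>B. u = \<phi> q" if "u \<in> Q" for u
  proof -
    have u: "u \<in> ball (\<phi> p) s" "u $ 2 > 0" using that by (auto simp: Q_def)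
    then have "u \<in> ball (\<phi> p) r \<inter> half_plane" using sb[OF u(1)] by (simp add: half_plane_def)
    then have "u \<in> \<phi> ` U" using rep unfolding local_rep_def by blast
    then obtain q where "q \<in> U" "u = \<phi> q" by blast
    then show ?thesis using u interior_iff[OF A(1), of q] by (auto simp: B_def W_def)
  qed
  have gB: "g (\<phi> q) = f q" "\<phi> q \<in> ball (\<phi> p) r" "\<phi> q \<in> ball (\<phi> p) s" "\<phi> q $ 2 > 0" if q: "q \<in> B" for q
  proof -
    show *: "\<phi> q \<in> ball (\<phi> p) s" "\<phi> q $ 2 > 0" using imO[OF q] by (auto simp: Q_def)
    then show "\<phi> q \<in> ball (\<phi> p) r" using sb by blast
    then show "g (\<phi> q) = f q" using rep_eq[OF A(1) rep] BU q by blast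
  qed
  have hO: "g u $ 3 > 0" "u \<in> ball (\<phi> p) r" "u \<in> ball (\<phi> p) s" "u $ 2 > 0" if u: "u \<in> Q" for u
  proof -
    obtain q where q: "q \<in> B" "u = \<phi> q" using preO[OF u] by blast
    then show "g u $ 3 > 0" "u \<in> ball (\<phi> p) r" "u \<in> ball (\<phi> p) s" "u $ 2 > 0"
      using gB[OF q(1)] height_pos[of q] BU by auto
  qed
  \<comment> \<open>\<open>?F\<close> is a Borel majorant, in coordinates, of the absolute
    curvature; its squared height cancels the one in the denominator of \<open>?d\<close>.\<close>
  let ?d = "\<lambda>u. ennreal (area_density ?\<psi> u)" and ?F = "\<lambda>u. ennreal (C * (g u $ 3)\<^sup>2) * indicator Q u"
  have dens: "area_density ?\<psi> u = ?n u / (g u $ 3)\<^sup>2" if u: "u \<in> Q" for u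
  proof -
    obtain q where q: "q \<in> B" "u = \<phi> q" using preO[OF u] by blast
    then have "q \<in> U" "q \<in> int_S" using BU by auto
    interpret imm: immersed_point ?\<psi> "\<phi> q" "g' (\<phi> q)" "\<lambda>v w. g'' (\<phi> q) v w"
      by (rule rep_immersed_point[OF A(1) rep \<open>q \<in> U\<close> gB(2)[OF q(1)] \<open>q \<in> int_S\<close>])
    show ?thesis
      using imm.area_density_eq gB(1)[OF q(1)] in_chart_apply(1)[OF A(1) \<open>q \<in> U\<close>] q(2) by simp
  qed
  have contg: "continuous_on Q (\<lambda>u. g u $ 3)"
    by (intro continuous_at_imp_continuous_on ballI isCont_vec_nth C2_with_isCont(1)[OF r(2)] hO)
  have contn: "continuous_on Q ?n"
    by (intro continuous_at_imp_continuous_on ballI continuous_norm isCont_normal_vec[OF r(2)] hO)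
  have "(\<lambda>u. ennreal (?n u / (g u $ 3)\<^sup>2) * indicator Q u) \<in> borel_measurable borel"
    using hO(1) by (intro borel_measurable_continuous_on_open_indicator openO continuous_intros contg contn) force
  moreover have "?d u * indicator Q u = ennreal (?n u / (g u $ 3)\<^sup>2) * indicator Q u" for u
    using dens[of u] by (auto simp: indicator_def)
  ultimately have dm: "(\<lambda>u. ?d u * indicator Q u) \<in> borel_measurable borel" by simp
  have Fm: "?F \<in> borel_measurable borel"
    by (intro borel_measurable_continuous_on_open_indicator openO continuous_intros contg)
  have \<phi>m: "\<phi> \<in> measurable (restrict_space dS B) borel"
  proof (rule borel_measurableI)
    fix S :: "(real^2) set" assume S: "open S"
    have sp: "space (restrict_space dS B) = B" using BU by (auto simp: space_restrict_space space_dS)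
    have "\<phi> -` S \<inter> B = {q \<in> U. \<phi> q \<in> S \<inter> ball (\<phi> p) s} \<inter> int_S"
      by (auto simp: B_def W_def)
    also have "\<dots> \<in> sets dS"
      using S by (intro openin_Int_sets_dS chart_preimage_open[OF A(1)]) auto
    finally show "\<phi> -` S \<inter> space (restrict_space dS B) \<in> sets (restrict_space dS B)"
      unfolding sp using B BU by (subst sets_restrict_space_iff) (auto simp: space_dS Int_absorb2)
  qed
  have em: "emeasure dS (\<phi> -` S \<inter> B) = (\<integral>\<^sup>+u. ?d u * indicator (S \<inter> Q) u \<partial>lborel)" if S: "S \<in> sets borel" for S
  proof -
    have sp: "space (restrict_space dS B) = B" using BU by (auto simp: space_restrict_space space_dS)
    have "\<phi> -` S \<inter> B \<in> sets (restrict_space dS B)" using measurable_sets[OF \<phi>m S] sp by simp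
    then have "\<phi> -` S \<inter> B \<in> sets dS"
      using B BU by (subst (asm) sets_restrict_space_iff) (auto simp: space_dS Int_absorb2)
    moreover have "\<phi> ` (\<phi> -` S \<inter> B) = S \<inter> Q" using imO preO by blast
    ultimately show ?thesis using emeasure_dS[OF A(1), of "\<phi> -` S \<inter> B"] BU by auto
  qed
  have "(\<integral>\<^sup>+q. ennreal \<bar>K q\<bar> * indicator (W \<inter> int_S) q \<partial>dS) \<le> (\<integral>\<^sup>+q. ?F (\<phi> q) * indicator B q \<partial>dS)"
  proof (rule nn_integral_mono)
    fix q
    show "ennreal \<bar>K q\<bar> * indicator (W \<inter> int_S) q \<le> ?F (\<phi> q) * indicator B q"
    proof (cases "q \<in> B")
      case True
      have "K q = ?k (\<phi> q)"
        using extrinsic_curvature_eq[OF A(1) rep _ gB(2)[OF True]] BU True gB(1)[OF True] by auto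
      then have "\<bar>K q\<bar> \<le> C * (g (\<phi> q) $ 3)\<^sup>2" using sb[OF gB(3)[OF True]] gB(4)[OF True] by simp
      then show ?thesis using imO[OF True] True by (simp add: B_def ennreal_leI)
    qed (auto simp: B_def indicator_def)
  qed
  also have "\<dots> = (\<integral>\<^sup>+u. ?d u * indicator Q u * ?F u \<partial>lborel)"
    by (rule nn_integral_chart[OF B \<phi>m dm em Fm])
  also have "\<dots> \<le> (\<integral>\<^sup>+u. ennreal (C * C) * indicator (ball (\<phi> p) s) u \<partial>lborel)"
  proof (rule nn_integral_mono)
    fix u
    show "?d u * indicator Q u * ?F u \<le> ennreal (C * C) * indicator (ball (\<phi> p) s) u"
    proof (cases "u \<in> Q")
      case True
      have "area_density ?\<psi> u * (C * (g u $ 3)\<^sup>2) = C * ?n u"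
        using dens[OF True] hO(1)[OF True] by simp
      also have "\<dots> \<le> C * C" using sb[OF hO(3)[OF True]] hO(4)[OF True] C(1) by simp
      finally have "ennreal (area_density ?\<psi> u * (C * (g u $ 3)\<^sup>2)) \<le> ennreal (C * C)" by (rule ennreal_leI)
      moreover have "ennreal (area_density ?\<psi> u * (C * (g u $ 3)\<^sup>2)) = ?d u * indicator Q u * ?F u"
        using True C(1) by (simp add: ennreal_mult'')
      ultimately show ?thesis using hO(3)[OF True] by simp
    qed auto
  qed
  also have "\<dots> = ennreal (C * C) * emeasure lborel (ball (\<phi> p) s)"
    by (simp add: nn_integral_cmult_indicator)
  also have "\<dots> < \<infinity>"
    using emeasure_bounded_finite[OF bounded_ball, of "\<phi> p" s] by (simp add: ennreal_mult_less_top)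
  finally show thesis using that W by blast
qed

text \<open>Integrability here is finiteness of the integral of the absolute value. The cover is one
  of all of \<open>X\<close>, where compactness is available, which is why local finiteness is
  needed at boundary points; overlaps are only overcounted, harmlessly for a nonnegative
  integrand.\<close>

lemma K_integrable: "integrable dS K"
proof (rule integrableI_bounded[OF K_measurable])
  let ?I = "\<lambda>W. \<integral>\<^sup>+q. ennreal \<bar>K q\<bar> * indicator (W \<inter> int_S) q \<partial>dS"
  let ?\<W> = "{W. openin X W \<and> ?I W < \<infinity>}"
  have "topspace X \<subseteq> \<Union>?\<W>"
  proof
    fix p assume "p \<in> topspace X"
    then obtain W where "openin X W" "p \<in> W" "?I W < \<infinity>" by (rule locally_finite_curvature)
    then show "p \<in> \<Union>?\<W>" by blast
  qed
  moreover have "\<forall>W\<in>?\<W>. openin X W" by simp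
  ultimately obtain \<F> where F: "finite \<F>" "\<F> \<subseteq> ?\<W>" "topspace X \<subseteq> \<Union>\<F>"
    using cpt unfolding compact_space_alt by meson
  have "(\<integral>\<^sup>+q. ennreal (norm (K q)) \<partial>dS) \<le> (\<integral>\<^sup>+q. (\<Sum>W\<in>\<F>. ennreal \<bar>K q\<bar> * indicator (W \<inter> int_S) q) \<partial>dS)"
  proof (rule nn_integral_mono)
    fix q assume "q \<in> space dS"
    then have q: "q \<in> int_S" by (simp add: space_dS)
    then obtain W where W: "W \<in> \<F>" "q \<in> W" using F(3) by (auto simp: surface_interior_def)
    have "ennreal (norm (K q)) = ennreal \<bar>K q\<bar> * indicator (W \<inter> int_S) q" using q W by simp
    also have "\<dots> \<le> (\<Sum>W\<in>\<F>. ennreal \<bar>K q\<bar> * indicator (W \<inter> int_S) q)"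
      using F(1) W(1) by (intro member_le_sum) auto
    finally show "ennreal (norm (K q)) \<le> (\<Sum>W\<in>\<F>. ennreal \<bar>K q\<bar> * indicator (W \<inter> int_S) q)" .
  qed
  also have "\<dots> = (\<Sum>W\<in>\<F>. ?I W)"
  proof (rule nn_integral_sum)
    fix W assume "W \<in> \<F>"
    then have "W \<inter> int_S \<in> sets dS" using F(2) openin_Int_sets_dS by blast
    then show "(\<lambda>q. ennreal \<bar>K q\<bar> * indicator (W \<inter> int_S) q) \<in> borel_measurable dS"
      using K_measurable by measurable
  qed
  also have "\<dots> < \<infinity>" using F(1,2) by (auto simp: less_top)
  finally show "(\<integral>\<^sup>+q. ennreal (norm (K q)) \<partial>dS) < \<infinity>" .
qed

end

theorem proposition7:
  fixes X :: "'p topology" and \<A> :: "'p chart set" and f :: "'p \<Rightarrow> real^3"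
    and C :: "(real^3) set" and dS :: "'p measure"
  assumes "connected_cone_like_end X \<A> f C"
    and "complete_surface X \<A> f"
    and "hyp_area_measure X \<A> f dS"
  shows "integrable dS (extrinsic_curvature \<A> f)"
proof -
  interpret cone_like_surface_area X \<A> f dS
    using assms by unfold_locales (simp_all add: connected_cone_like_end_def)
  show ?thesis by (rule K_integrable)
qed

end
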